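(* Let $\mathcal P\subseteq 2^{\omega}$ be a nonempty $\Pi^0_1$ class, and let $\mathbf c$ be a monotonic cost function satisfying the limit condition. Then there is a $\Delta^0_2$ set $Y\in\mathcal P$ such that each c.e. set $A\le_TY$ obeys $\mathbf c$.
   Context: A cost function is a computable function $\mathbf c:\mathbb N\times\mathbb N\to\{q\in\mathbb Q: q\ge 0\}$. It is monotonic if for all $x,s$: $\mathbf c(x+1,s)\le \mathbf c(x,s)$; $\mathbf c(x,s)=0$ whenever $x>s$; and $\mathbf c(x,s)\le\mathbf c(x,s+1)$. It satisfies the limit condition if $\lim_x\liminf_s\mathbf c(x,s)=0$. A computable approximation of a set $A\subseteq\mathbb N$ is a computable sequence of finite sets $\langle A_s\rangle_{s\in\mathbb N}$ such that $\lim_s A_s(x)=A(x)$ for each $x$. For $s>0$ let $\mathbf c_s(A_s)=\mathbf c(x,s)$, where $x<s$ and $x$ is least such that $A_{s-1}(x)\ne A_s(x)$; if there is no such $x$, let $\mathbf c_s(A_s)=0$. A $\Delta^0_2$ set $A$ obeys $\mathbf c$ if some computable approximation of $A$ satisfies $\sum_{s>0}\mathbf c_s(A_s)<\infty$. *)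

theory Defs
  imports
    "HOL-Library.Nat_Bijection"
    "HOL-Library.Sublist"
    "HOL-Library.Extended_Real"
    "HOL-Library.Liminf_Limsup"
begin

section \<open>Partial recursive functions with an oracle\<close>

text \<open>
  Subsets of the natural numbers are identified with their characteristic
  functions, so Cantor space is the type \<^typ>\<open>nat set\<close>.
\<close>

datatype recf =
    Zero
  | Succ
  | Proj nat
  | Oracle
  | Comp recf "recf list"
  | Prim recf recf
  | Mu recf

text \<open>
  \<open>reval X p xs y\<close>: with oracle \<open>X\<close>, the program \<open>p\<close> halts on the arguments \<open>xs\<close>
  with output \<open>y\<close>. Divergence is the absence of an output. In \<open>Prim f g\<close> the recursion variable
  comes first and \<open>g\<close> receives the predecessor, the previous value and the
  parameters; \<open>Mu f\<close> searches in the first argument of \<open>f\<close>.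
  Arities are not recorded in the syntax: superfluous arguments are ignored, and a missing
  argument means divergence.
\<close>

inductive reval :: "nat set \<Rightarrow> recf \<Rightarrow> nat list \<Rightarrow> nat \<Rightarrow> bool" for X where
  Zero: "reval X Zero xs 0"
| Succ: "reval X Succ (x # xs) (Suc x)"
| Proj: "i < length xs \<Longrightarrow> reval X (Proj i) xs (xs ! i)"
| Oracle: "reval X Oracle (x # xs) (of_bool (x \<in> X))"
| Comp: "length ys = length gs \<Longrightarrow> (\<forall>i<length gs. reval X (gs ! i) xs (ys ! i)) \<Longrightarrow>
    reval X f ys z \<Longrightarrow> reval X (Comp f gs) xs z"
| Prim_0: "reval X f xs y \<Longrightarrow> reval X (Prim f g) (0 # xs) y"
| Prim_Suc: "reval X (Prim f g) (n # xs) r \<Longrightarrow> reval X g (n # r # xs) y \<Longrightarrow>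
    reval X (Prim f g) (Suc n # xs) y"
| Mu: "reval X f (n # xs) 0 \<Longrightarrow> (\<forall>m<n. \<exists>k. reval X f (m # xs) (Suc k)) \<Longrightarrow>
    reval X (Mu f) xs n"

inductive_cases reval_ZeroE: "reval X Zero xs y"
inductive_cases reval_SuccE: "reval X Succ xs y"
inductive_cases reval_ProjE: "reval X (Proj i) xs y"
inductive_cases reval_OracleE: "reval X Oracle xs y"
inductive_cases reval_CompE: "reval X (Comp f gs) xs y"
inductive_cases reval_Prim_0E: "reval X (Prim f g) (0 # xs) y"
inductive_cases reval_Prim_SucE: "reval X (Prim f g) (Suc n # xs) y"
inductive_cases reval_MuE: "reval X (Mu f) xs y"

lemma reval_deterministic:
  "reval X p xs y \<Longrightarrow> reval X p xs z \<Longrightarrow> y = z"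
proof (induction arbitrary: z rule: reval.induct)
  case (Zero xs)
  then show ?case by (rule reval_ZeroE) simp
next
  case (Succ x xs)
  then show ?case by (rule reval_SuccE) simp
next
  case (Proj i xs)
  from Proj.prems show ?case by (rule reval_ProjE) simp
next
  case (Oracle x xs)
  then show ?case by (rule reval_OracleE) simp
next
  case (Comp ys gs xs f w)
  from Comp.prems obtain ys' where ys': "length ys' = length gs"
    "\<forall>i<length gs. reval X (gs ! i) xs (ys' ! i)" "reval X f ys' z"
    by (rule reval_CompE) blast
  have "ys = ys'"
    by (rule nth_equalityI) (use Comp.hyps Comp.IH ys' in auto)
  with Comp.IH ys' show ?case by blast
next
  case (Prim_0 f xs y g)
  from Prim_0.prems have "reval X f xs z" by (rule reval_Prim_0E)
  then show ?case by (rule Prim_0.IH)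
next
  case (Prim_Suc f g n xs r y)
  from Prim_Suc.prems obtain r' where r': "reval X (Prim f g) (n # xs) r'"
    "reval X g (n # r' # xs) z"
    by (rule reval_Prim_SucE)
  from r'(1) have "r = r'" by (rule Prim_Suc.IH)
  with r'(2) show ?case using Prim_Suc.IH(2) by simp
next
  case (Mu f n xs)
  from Mu.prems have z: "reval X f (z # xs) 0" "\<forall>m<z. \<exists>k. reval X f (m # xs) (Suc k)"
    by (rule reval_MuE, blast)+
  show ?case
  proof (rule linorder_cases)
    assume "n < z"
    with z(2) Mu.IH(1) show ?thesis by blast
  next
    assume "z < n"
    with z(1) Mu.IH(2) show ?thesis by blast
  qed
qed

definition computable_in :: "nat set \<Rightarrow> nat \<Rightarrow> (nat list \<Rightarrow> nat) \<Rightarrow> bool" where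
  "computable_in X k f \<longleftrightarrow> (\<exists>p. \<forall>xs. length xs = k \<longrightarrow> reval X p xs (f xs))"

text \<open>Unrelativised computability is computability with the empty oracle.\<close>

definition computable1 :: "(nat \<Rightarrow> nat) \<Rightarrow> bool" where
  "computable1 f \<longleftrightarrow> computable_in {} 1 (\<lambda>xs. f (xs ! 0))"

definition computable2 :: "(nat \<Rightarrow> nat \<Rightarrow> nat) \<Rightarrow> bool" where
  "computable2 f \<longleftrightarrow> computable_in {} 2 (\<lambda>xs. f (xs ! 0) (xs ! 1))"

definition computable3 :: "(nat \<Rightarrow> nat \<Rightarrow> nat \<Rightarrow> nat) \<Rightarrow> bool" where
  "computable3 f \<longleftrightarrow> computable_in {} 3 (\<lambda>xs. f (xs ! 0) (xs ! 1) (xs ! 2))"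

definition turing_reducible :: "nat set \<Rightarrow> nat set \<Rightarrow> bool" (infix "\<le>\<^sub>T" 50) where
  "A \<le>\<^sub>T Y \<longleftrightarrow> computable_in Y 1 (\<lambda>xs. of_bool (xs ! 0 \<in> A))"

definition computable_set :: "nat set \<Rightarrow> bool" where
  "computable_set A \<longleftrightarrow> computable1 (\<lambda>x. of_bool (x \<in> A))"

definition ce_set :: "nat set \<Rightarrow> bool" where
  "ce_set A \<longleftrightarrow> (\<exists>p. A = {x. \<exists>y. reval {} p [x] y})"

definition sigma02 :: "nat set \<Rightarrow> bool" where
  "sigma02 A \<longleftrightarrow> (\<exists>R. computable3 (\<lambda>x y z. of_bool (R x y z)) \<and> A = {x. \<exists>y. \<forall>z. R x y z})"

definition pi02 :: "nat set \<Rightarrow> bool" where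
  "pi02 A \<longleftrightarrow> (\<exists>R. computable3 (\<lambda>x y z. of_bool (R x y z)) \<and> A = {x. \<forall>y. \<exists>z. R x y z})"

definition delta02 :: "nat set \<Rightarrow> bool" where
  "delta02 A \<longleftrightarrow> sigma02 A \<and> pi02 A"

section \<open>Effectively closed classes\<close>

definition string_code :: "bool list \<Rightarrow> nat" where
  "string_code \<sigma> = list_encode (map of_bool \<sigma>)"

definition restrict :: "nat set \<Rightarrow> nat \<Rightarrow> bool list" where
  "restrict X n = map (\<lambda>i. i \<in> X) [0..<n]"

definition computable_tree :: "bool list set \<Rightarrow> bool" where
  "computable_tree T \<longleftrightarrow>
    computable_set (string_code ` T) \<and> (\<forall>\<sigma>\<in>T. \<forall>\<tau>. prefix \<tau> \<sigma> \<longrightarrow> \<tau> \<in> T)"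

definition paths :: "bool list set \<Rightarrow> nat set set" where
  "paths T = {X. \<forall>n. restrict X n \<in> T}"

definition pi01_class :: "nat set set \<Rightarrow> bool" where
  "pi01_class P \<longleftrightarrow> (\<exists>T. computable_tree T \<and> P = paths T)"

section \<open>Cost functions\<close>

definition cost_function :: "(nat \<Rightarrow> nat \<Rightarrow> rat) \<Rightarrow> bool" where
  "cost_function c \<longleftrightarrow> (\<forall>x s. c x s \<ge> 0) \<and>
    (\<exists>n d. computable2 n \<and> computable2 d \<and>
      (\<forall>x s. d x s > 0 \<and> c x s = of_nat (n x s) / of_nat (d x s)))"

definition monotonic_cost :: "(nat \<Rightarrow> nat \<Rightarrow> rat) \<Rightarrow> bool" where
  "monotonic_cost c \<longleftrightarrow>
    (\<forall>x s. c (x + 1) s \<le> c x s \<and> (x > s \<longrightarrow> c x s = 0) \<and> c x s \<le> c x (s + 1))"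

text \<open>
  The limit inferior is taken in the extended reals since it may be infinite for
  some \<open>x\<close>; the limit condition excludes this only for almost all \<open>x\<close>.
\<close>

definition limit_condition :: "(nat \<Rightarrow> nat \<Rightarrow> rat) \<Rightarrow> bool" where
  "limit_condition c \<longleftrightarrow>
    (\<lambda>x. liminf (\<lambda>s. ereal (real_of_rat (c x s)))) \<longlonglongrightarrow> 0"

text \<open>
  A sequence of finite sets is computable if its sequence of canonical
  indices \<open>\<Sum>x\<in>A s. 2 ^ x\<close> is; these are the values of \<^const>\<open>set_encode\<close>
  (on finite sets only).
\<close>

definition computable_approximation :: "(nat \<Rightarrow> nat set) \<Rightarrow> nat set \<Rightarrow> bool" where
  "computable_approximation As A \<longleftrightarrow>
    (\<forall>s. finite (As s)) \<and> computable1 (\<lambda>s. set_encode (As s)) \<and>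
    (\<forall>x. \<forall>\<^sub>F s in sequentially. x \<in> As s \<longleftrightarrow> x \<in> A)"

text \<open>Only meaningful for \<open>s > 0\<close>.\<close>

definition stage_cost :: "(nat \<Rightarrow> nat \<Rightarrow> rat) \<Rightarrow> (nat \<Rightarrow> nat set) \<Rightarrow> nat \<Rightarrow> rat" where
  "stage_cost c As s =
    (let changes = (\<lambda>x. x < s \<and> (x \<in> As (s - 1)) \<noteq> (x \<in> As s))
     in if \<exists>x. changes x then c (LEAST x. changes x) s else 0)"

text \<open>The terms are nonnegative, so a finite sum means summability; the shift omits stage 0.\<close>

definition obeys :: "nat set \<Rightarrow> (nat \<Rightarrow> nat \<Rightarrow> rat) \<Rightarrow> bool" where
  "obeys A c \<longleftrightarrow> (\<exists>As. computable_approximation As A \<and>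
    summable (\<lambda>s. real_of_rat (stage_cost c As (Suc s))))"

end

theory Submission
  imports Defs "HOL-Library.More_List"
begin

text \<open>
  At stage \<open>t\<close>, a list of modules acts in turn on a class of strings of length \<open>t\<close>, starting with those
  of the tree. A module for a c.e. set \<open>A\<close> and a functional \<open>\<Phi>\<close> passes to the oracles that do not
  compute the current approximation of \<open>A\<close> correctly below a certain length, if there are any. Otherwise
  it stays idle, and the class certifies the approximation: if some \<open>x\<close> below the length is enumerated into
  \<open>A\<close> later on, then all oracles in the class are wrong for good, so that the module can act unless the class
  has changed. The outcomes converge, and determine a limit path \<open>Y\<close>.

  If \<open>A = \<Phi>(Y)\<close>, then no module for \<open>A\<close> acts in the limit. The approximation of \<open>A\<close> that obeys the cost
  function skips to stages \<open>t\<^sub>0 < t\<^sub>1 < \<dots>\<close> at which the modules for \<open>A\<close>, and those for requirements of higher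
  priority that are idle in the limit, are all idle below a growing horizon. Then each change of \<open>A\<close> between
  two such stages is due to a change of a module of lower priority. It costs little, because \<open>t\<^sub>i > i\<close> and the
  lengths, computed from the cost at stage \<open>t\<^sub>i\<close>, dominate the number of such changes.
\<close>

section \<open>Closure properties of computable functions\<close>

text \<open>The obstacle is a circle: a length of agreement must be cheap compared with the number
  of later changes of other modules, but that number depends on their lengths, which may grow from
  stage to stage. It is broken in two ways. The lengths are defined along one linear order, each
  from the preceding one, with the costs of the current stage. And changes are not counted against a
  bound fixed in advance, but by a potential: the \<open>state\<close> of a module never decreases
  while the modules before it stand still, and it grows whenever its outcome changes. So all changes
  that happen on one diagonal carry different vectors of states. Weighting a vector by the product
  of \<open>(1/2) ^ Suc v\<close> over its entries \<open>v\<close> turns these vectors into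
  disjoint events of a probability space, so that their weights sum to at most 1 however many there
  are; \<open>weight\<close> is chosen so that a single step costs less than this product. The
  approximation is not uniform in the requirement: finitely many limit outcomes enter as
  constants.\<close>

lemma computable_in_cong:
  assumes "computable_in X k f" and "\<And>xs. length xs = k \<Longrightarrow> f xs = g xs"
  shows "computable_in X k g"
  using assms unfolding computable_in_def by metis

lemma computable_in_compose:
  assumes "computable_in X (length fs) h" and "\<And>f. f \<in> set fs \<Longrightarrow> computable_in X k f"
  shows "computable_in X k (\<lambda>xs. h (map (\<lambda>f. f xs) fs))"
proof -
  obtain p where p: "\<And>xs. length xs = length fs \<Longrightarrow> reval X p xs (h xs)"
    using assms(1) unfolding computable_in_def by blast
  have "\<forall>f\<in>set fs. \<exists>q. \<forall>xs. length xs = k \<longrightarrow> reval X q xs (f xs)"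
    using assms(2) unfolding computable_in_def by blast
  then obtain q where q: "\<And>f xs. f \<in> set fs \<Longrightarrow> length xs = k \<Longrightarrow> reval X (q f) xs (f xs)"
    by metis
  show ?thesis
    unfolding computable_in_def
    by (intro exI[of _ "recf.Comp p (map q fs)"] allI impI, rule reval.Comp[where ys = "map (\<lambda>f. f _) fs"])
       (auto intro!: p q)
qed

lemma computable_in_const: "computable_in X k (\<lambda>xs. n)"
proof (induction n)
  case 0
  then show ?case unfolding computable_in_def by (blast intro: reval.Zero)
next
  case (Suc n)
  have "computable_in X 1 (\<lambda>xs. Suc (xs ! 0))"
    unfolding computable_in_def
    by (intro exI[of _ recf.Succ]) (auto simp: length_Suc_conv intro: reval.Succ)
  with Suc computable_in_compose[of X "[\<lambda>xs. n]" "\<lambda>xs. Suc (xs ! 0)" k] show ?case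
    by simp
qed

lemma computable_in_nth: "i < k \<Longrightarrow> computable_in X k (\<lambda>xs. xs ! i)"
  unfolding computable_in_def by (blast intro: reval.Proj)

lemma computable_in_rec_nat:
  assumes "computable_in X k f" and "computable_in X (Suc (Suc k)) g"
  shows "computable_in X (Suc k) (\<lambda>xs. rec_nat (f (tl xs)) (\<lambda>n r. g (n # r # tl xs)) (hd xs))"
proof -
  obtain p where p: "\<And>xs. length xs = k \<Longrightarrow> reval X p xs (f xs)"
    using assms(1) unfolding computable_in_def by blast
  obtain q where q: "\<And>xs. length xs = Suc (Suc k) \<Longrightarrow> reval X q xs (g xs)"
    using assms(2) unfolding computable_in_def by blast
  have "reval X (Prim p q) (n # xs) (rec_nat (f xs) (\<lambda>n r. g (n # r # xs)) n)"
    if "length xs = k" for n xs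
    by (induction n) (auto intro!: reval.Prim_0 reval.Prim_Suc p q simp: that)
  then show ?thesis
    unfolding computable_in_def
    by (intro exI[of _ "Prim p q"]) (auto simp: length_Suc_conv)
qed

lemma computable1_compose:
  "computable1 f \<Longrightarrow> computable_in {} k g \<Longrightarrow> computable_in {} k (\<lambda>xs. f (g xs))"
  using computable_in_compose[of "{}" "[g]" "\<lambda>xs. f (xs ! 0)" k] unfolding computable1_def by simp

lemma computable2_compose:
  "computable2 f \<Longrightarrow> computable_in {} k g \<Longrightarrow> computable_in {} k h \<Longrightarrow>
    computable_in {} k (\<lambda>xs. f (g xs) (h xs))"
  using computable_in_compose[of "{}" "[g, h]" "\<lambda>xs. f (xs ! 0) (xs ! 1)" k]
  unfolding computable2_def by (auto simp: numeral_2_eq_2)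

lemma computable1_rec_nat:
  assumes "computable2 g"
  shows "computable1 (rec_nat a g)"
proof -
  have "computable_in {} (Suc 0) (\<lambda>xs. rec_nat a (\<lambda>n r. g ((n # r # tl xs) ! 0) ((n # r # tl xs) ! 1)) (hd xs))"
    by (rule computable_in_rec_nat[of _ 0 "\<lambda>xs. a" "\<lambda>xs. g (xs ! 0) (xs ! 1)"])
       (use assms in \<open>auto simp: computable2_def numeral_2_eq_2 intro: computable_in_const\<close>)
  then show ?thesis
    unfolding computable1_def One_nat_def
    by (rule computable_in_cong) (auto simp: length_Suc_conv)
qed

lemma computable2_rec_nat:
  assumes "computable1 f" "computable3 g"
  shows "computable2 (\<lambda>n x. rec_nat (f x) (\<lambda>m r. g m r x) n)"
proof -
  have "computable_in {} (Suc 1) (\<lambda>xs. rec_nat (f (tl xs ! 0)) (\<lambda>n r. g ((n # r # tl xs) ! 0) ((n # r # tl xs) ! 1)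
      ((n # r # tl xs) ! 2)) (hd xs))"
    by (rule computable_in_rec_nat[of _ 1 "\<lambda>xs. f (xs ! 0)" "\<lambda>xs. g (xs ! 0) (xs ! 1) (xs ! 2)"])
       (use assms in \<open>auto simp: computable1_def computable3_def numeral_3_eq_3\<close>)
  then show ?thesis
    unfolding computable2_def numeral_2_eq_2 One_nat_def
    by (rule computable_in_cong) (auto simp: length_Suc_conv)
qed

section \<open>Arithmetic and pairing of natural numbers\<close>

lemma computable1_Suc: "computable1 Suc"
  unfolding computable1_def computable_in_def
  by (intro exI[of _ recf.Succ]) (auto simp: length_Suc_conv intro: reval.Succ)

lemma computable2_add: "computable2 (+)"
proof -
  have "computable2 (\<lambda>n x. rec_nat x (\<lambda>m r. Suc r) n)"
    by (rule computable2_rec_nat)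
       (auto simp: computable1_def computable3_def
         intro!: computable_in_nth computable1_compose[OF computable1_Suc])
  moreover have "rec_nat x (\<lambda>m. Suc) n = n + x" for n x :: nat
    by (induction n) auto
  ultimately show ?thesis by simp
qed

lemma computable2_mult: "computable2 (*)"
proof -
  have "computable2 (\<lambda>n x. rec_nat 0 (\<lambda>m r. r + x) n)"
    by (rule computable2_rec_nat)
       (auto simp: computable1_def computable3_def
         intro!: computable_in_nth computable_in_const computable2_compose[OF computable2_add])
  moreover have "rec_nat 0 (\<lambda>m r. r + x) n = n * x" for n x :: nat
    by (induction n) auto
  ultimately show ?thesis by simp
qed

text \<open>The arguments are swapped because the recursion runs on the first one, and it is the
  subtrahend that counts the applications of the predecessor.\<close>

lemma computable2_diff: "computable2 (\<lambda>n x. x - n)"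
proof -
  have "computable1 (rec_nat 0 (\<lambda>m r. m))"
    by (rule computable1_rec_nat) (auto simp: computable2_def intro: computable_in_nth)
  moreover have "rec_nat 0 (\<lambda>m r. m) n = n - 1" for n :: nat
    by (cases n) auto
  ultimately have pred: "computable1 (\<lambda>n. n - 1)" by (metis ext)
  have "computable2 (\<lambda>n x. rec_nat x (\<lambda>m r. r - 1) n)"
    by (rule computable2_rec_nat)
       (auto simp: computable1_def computable3_def
         intro!: computable_in_nth computable_in_const computable1_compose[OF pred, unfolded One_nat_def])
  moreover have "rec_nat x (\<lambda>m r. r - 1) n = x - n" for n x :: nat
    by (induction n) auto
  ultimately show ?thesis by simp
qed

lemma computable1_triangle: "computable1 triangle"
proof -
  have "computable1 (rec_nat 0 (\<lambda>m r. r + Suc m))"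
    by (rule computable1_rec_nat)
       (auto simp: computable2_def computable_in_nth
         intro!: computable2_compose[OF computable2_add] computable1_compose[OF computable1_Suc])
  moreover have "rec_nat 0 (\<lambda>m r. r + Suc m) n = triangle n" for n
    by (induction n) auto
  ultimately show ?thesis by (metis ext)
qed

lemma computable2_prod_encode: "computable2 (\<lambda>x y. prod_encode (x, y))"
  unfolding prod_encode_def prod.case computable2_def
  by (intro computable2_compose[OF computable2_add] computable1_compose[OF computable1_triangle]
      computable_in_nth) auto

text \<open>The diagonal containing a given code is found by counting up.\<close>

lemma computable1_prod_decode:
  shows "computable1 (\<lambda>n. fst (prod_decode n))" "computable1 (\<lambda>n. snd (prod_decode n))"
proof -
  \<comment> \<open>With truncated subtraction the increment is a 0-1 test: it is 1 exactly when
    \<open>Suc m\<close> has reached the next triangular number.\<close>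
  define diag where "diag = rec_nat 0 (\<lambda>m r. r + (1 - (triangle (Suc r) - Suc m)))"
  have "computable1 diag"
    unfolding diag_def
    by (rule computable1_rec_nat)
       (auto simp: computable2_def computable_in_nth computable_in_const
         simp del: triangle_Suc
         intro!: computable2_compose[OF computable2_add] computable2_compose[OF computable2_diff]
           computable1_compose[OF computable1_Suc] computable1_compose[OF computable1_triangle])
  note diag = computable1_compose[OF this]
  have diag_Suc: "diag (Suc m) = (if triangle (Suc (diag m)) \<le> Suc m then Suc (diag m) else diag m)" for m
    by (auto simp: diag_def simp del: triangle_Suc)
  have bounds: "triangle (diag n) \<le> n \<and> n < triangle (Suc (diag n))" for n
  proof (induction n)
    case (Suc n)
    then show ?case by (auto simp: diag_Suc)
  qed (simp add: diag_def)
  have decode: "prod_decode n = (n - triangle (diag n), diag n - (n - triangle (diag n)))" for n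
  proof -
    have "prod_encode (n - triangle (diag n), diag n - (n - triangle (diag n))) = n"
      using bounds[of n] by (auto simp: prod_encode_def)
    then show ?thesis by (metis prod_encode_inverse)
  qed
  show "computable1 (\<lambda>n. fst (prod_decode n))" "computable1 (\<lambda>n. snd (prod_decode n))"
    unfolding decode fst_conv snd_conv computable1_def
    by (auto intro!: diag computable2_compose[OF computable2_diff] computable1_compose[OF computable1_triangle]
        computable_in_nth)
qed

section \<open>Computable functions on encoded data\<close>

class enc =
  fixes enc :: "'a \<Rightarrow> nat"
  assumes inj_enc: "inj enc"
begin

lemma enc_eq_iff [simp]: "enc x = enc y \<longleftrightarrow> x = y"
  using inj_enc by (auto dest: injD)

end

instantiation nat :: enc
begin
definition enc_nat :: "nat \<Rightarrow> nat" where [simp]: "enc_nat n = n"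
instance by standard (simp add: inj_def)
end

instantiation bool :: enc
begin
definition enc_bool :: "bool \<Rightarrow> nat" where [simp]: "enc_bool b = of_bool b"
instance by standard (simp add: inj_def)
end

instantiation prod :: (enc, enc) enc
begin
definition enc_prod :: "'a \<times> 'b \<Rightarrow> nat" where
  "enc_prod z = prod_encode (enc (fst z), enc (snd z))"
instance by standard (auto simp: inj_def enc_prod_def prod_eq_iff)
end

instantiation list :: (enc) enc
begin
definition enc_list :: "'a list \<Rightarrow> nat" where
  "enc_list xs = list_encode (map enc xs)"
instance
proof
  show "inj (enc :: 'a list \<Rightarrow> nat)"
  proof (rule injI)
    fix x y :: "'a list"
    assume "enc x = enc y"
    then have "map enc x = map enc y" by (simp add: enc_list_def list_encode_eq)
    then show "x = y" by (simp add: inj_map_eq_map inj_enc)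
  qed
qed
end

instantiation option :: (enc) enc
begin
definition enc_option :: "'a option \<Rightarrow> nat" where
  "enc_option z = (case z of None \<Rightarrow> 0 | Some x \<Rightarrow> Suc (enc x))"
instance by standard (auto simp: inj_def enc_option_def split: option.splits)
end

lemma enc_simps [simp]:
  "enc (x, y) = prod_encode (enc x, enc y)"
  "enc [] = 0" "enc (x # xs) = Suc (prod_encode (enc x, enc xs))"
  "enc None = 0" "enc (Some x) = Suc (enc x)"
  by (simp_all add: enc_prod_def enc_list_def enc_option_def)

lemma enc_bool_list: "enc \<sigma> = string_code \<sigma>"
proof -
  have "(enc :: bool \<Rightarrow> nat) = of_bool" by (simp add: fun_eq_iff)
  then show ?thesis by (simp add: enc_list_def string_code_def)
qed

lemma enc_nat_list: "enc (xs :: nat list) = list_encode xs"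
proof -
  have "(enc :: nat \<Rightarrow> nat) = id" by (simp add: fun_eq_iff)
  then show ?thesis by (simp add: enc_list_def)
qed

text \<open>The program is constrained on codes of arguments only; on other numbers it may behave
  arbitrarily or diverge.\<close>

definition cfun :: "('a::enc \<Rightarrow> 'b::enc) \<Rightarrow> bool" where
  "cfun f \<longleftrightarrow> (\<exists>p. \<forall>x. reval {} p [enc x] (enc (f x)))"

lemma cfunI:
  assumes "computable1 g" and "\<And>x. enc (f x) = g (enc x)"
  shows "cfun f"
proof -
  obtain p where "\<And>xs. length xs = 1 \<Longrightarrow> reval {} p xs (g (xs ! 0))"
    using assms(1) unfolding computable1_def computable_in_def by blast
  from this[of "[enc _]"] have "reval {} p [enc x] (enc (f x))" for x
    by (simp add: assms(2))
  then show ?thesis unfolding cfun_def by blast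
qed

lemma cfun_nat_iff: "cfun (f :: nat \<Rightarrow> nat) \<longleftrightarrow> computable1 f"
proof -
  have "(\<forall>xs. length xs = 1 \<longrightarrow> reval {} p xs (f (xs ! 0))) \<longleftrightarrow> (\<forall>x. reval {} p [x] (f x))" for p
    by (metis One_nat_def length_0_conv length_Suc_conv nth_Cons_0)
  then show ?thesis by (simp add: cfun_def computable1_def computable_in_def)
qed

lemma cfun_cong: "cfun f \<Longrightarrow> (\<And>x. f x = g x) \<Longrightarrow> cfun g"
  by (simp add: cfun_def)

lemma cfun_comp:
  assumes "cfun g" "cfun f"
  shows "cfun (\<lambda>x. g (f x))"
proof -
  obtain p q where p: "\<And>x. reval {} p [enc x] (enc (f x))" and q: "\<And>x. reval {} q [enc x] (enc (g x))"
    using assms unfolding cfun_def by blast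
  show ?thesis unfolding cfun_def
    by (intro exI[of _ "recf.Comp q [p]"] allI, rule reval.Comp[where ys = "[enc (f _)]"])
       (auto intro: p q)
qed

lemma cfun_computable1: "computable1 F \<Longrightarrow> cfun f \<Longrightarrow> cfun (\<lambda>x. F (f x))"
  by (rule cfun_comp[of F f]) (simp_all add: cfun_nat_iff)

lemma cfun_computable2:
  assumes "computable2 F" "cfun f" "cfun g" and "\<And>x. enc (h x) = F (enc (f x)) (enc (g x))"
  shows "cfun h"
proof -
  obtain p q r where p: "\<And>x. reval {} p [enc x] (enc (f x))" and q: "\<And>x. reval {} q [enc x] (enc (g x))"
    and r: "\<And>xs. length xs = 2 \<Longrightarrow> reval {} r xs (F (xs ! 0) (xs ! 1))"
    using assms(1,2,3) unfolding cfun_def computable2_def computable_in_def by blast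
  have "reval {} (recf.Comp r [p, q]) [enc x] (enc (h x))" for x
    by (rule reval.Comp[where ys = "[enc (f x), enc (g x)]"])
       (use p q r[of "[enc (f x), enc (g x)]"] assms(4) in \<open>auto simp: less_Suc_eq\<close>)
  then show ?thesis unfolding cfun_def by blast
qed

named_theorems cfun_intros

text \<open>For maps that change the type but not the underlying number, such as
  \<open>prod_decode\<close> and \<open>list_encode\<close>.\<close>

lemma cfunI_same_code: "(\<And>x. enc (f x) = enc x) \<Longrightarrow> cfun f"
  by (rule cfunI[of "\<lambda>x. x"]) (simp_all add: computable1_def computable_in_nth)

lemma cfun_id [cfun_intros]: "cfun (\<lambda>x. x)"
  by (rule cfunI[of "\<lambda>x. x"]) (simp_all add: computable1_def computable_in_nth)

lemma cfun_const [cfun_intros]: "cfun (\<lambda>x. c)"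
  by (rule cfunI[of "\<lambda>x. enc c"]) (simp_all add: computable1_def computable_in_const)

lemma cfun_Pair [cfun_intros]: "cfun f \<Longrightarrow> cfun g \<Longrightarrow> cfun (\<lambda>x. (f x, g x))"
  by (rule cfun_computable2[OF computable2_prod_encode, of f g]) simp_all

lemma cfun_fst [cfun_intros]: "cfun f \<Longrightarrow> cfun (\<lambda>x. fst (f x))"
  by (rule cfun_comp[OF cfunI[OF computable1_prod_decode(1)]]) (simp add: enc_prod_def)

lemma cfun_snd [cfun_intros]: "cfun f \<Longrightarrow> cfun (\<lambda>x. snd (f x))"
  by (rule cfun_comp[OF cfunI[OF computable1_prod_decode(2)]]) (simp add: enc_prod_def)

lemma cfun_prod_decode [cfun_intros]: "cfun f \<Longrightarrow> cfun (\<lambda>x. prod_decode (f x))"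
  by (rule cfun_comp[OF cfunI_same_code]) (simp add: enc_prod_def)

lemma cfun_prod_encode [cfun_intros]:
  "cfun f \<Longrightarrow> cfun g \<Longrightarrow> cfun (\<lambda>x. prod_encode (f x, g x))"
  by (rule cfun_computable2[OF computable2_prod_encode, of f g]) simp_all

lemma cfun_list_encode [cfun_intros]: "cfun f \<Longrightarrow> cfun (\<lambda>x. list_encode (f x))"
  by (rule cfun_comp[OF cfunI_same_code]) (simp add: enc_nat_list)

lemma cfun_list_decode [cfun_intros]: "cfun f \<Longrightarrow> cfun (\<lambda>x. list_decode (f x))"
  by (rule cfun_comp[OF cfunI_same_code]) (simp add: enc_nat_list)

lemma cfun_Suc [cfun_intros]: "cfun f \<Longrightarrow> cfun (\<lambda>x. Suc (f x))"
  by (rule cfun_computable1[OF computable1_Suc])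

lemma cfun_add [cfun_intros]: "cfun f \<Longrightarrow> cfun g \<Longrightarrow> cfun (\<lambda>x. (f x :: nat) + g x)"
  by (rule cfun_computable2[OF computable2_add, of f g]) simp_all

lemma cfun_mult [cfun_intros]: "cfun f \<Longrightarrow> cfun g \<Longrightarrow> cfun (\<lambda>x. (f x :: nat) * g x)"
  by (rule cfun_computable2[OF computable2_mult, of f g]) simp_all

lemma cfun_diff [cfun_intros]: "cfun f \<Longrightarrow> cfun g \<Longrightarrow> cfun (\<lambda>x. (f x :: nat) - g x)"
  by (rule cfun_computable2[OF computable2_diff, of g f]) simp_all

lemma cfun_of_bool [cfun_intros]: "cfun f \<Longrightarrow> cfun (\<lambda>x. of_bool (f x) :: nat)"
  by (rule cfun_comp[OF cfunI_same_code]) simp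

lemma computable2_nat_op:
  assumes "cfun (\<lambda>z. F (fst z) (snd z) :: nat)"
  shows "computable2 F"
proof -
  have "computable1 (\<lambda>z. F (fst (prod_decode z)) (snd (prod_decode z)))"
    unfolding cfun_nat_iff[symmetric]
    by (rule cfun_comp[of "\<lambda>z. F (fst z) (snd z)" prod_decode]) (intro assms cfun_intros)+
  from computable1_compose[OF this computable2_prod_encode[unfolded computable2_def]]
  show ?thesis unfolding computable2_def by simp
qed

lemma computable3_nat_op:
  assumes "cfun (\<lambda>z. F (fst z) (fst (snd z)) (snd (snd z)) :: nat)"
  shows "computable3 F"
proof -
  have "computable1 (\<lambda>z. F (fst (prod_decode z)) (fst (prod_decode (snd (prod_decode z))))
      (snd (prod_decode (snd (prod_decode z)))))"
    unfolding cfun_nat_iff[symmetric]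
    using cfun_comp[OF assms, of "\<lambda>z. (fst (prod_decode z), prod_decode (snd (prod_decode z)))"]
    by (simp add: cfun_intros)
  from computable1_compose[OF this, of 3 "\<lambda>xs. prod_encode (xs ! 0, prod_encode (xs ! 1, xs ! 2))"]
  show ?thesis unfolding computable3_def
    by (simp add: computable2_compose[OF computable2_prod_encode] computable_in_nth)
qed

section \<open>Decidable relations, recursion and search\<close>

lemma cfun_le [cfun_intros]:
  assumes "cfun f" "cfun g"
  shows "cfun (\<lambda>x. (f x :: nat) \<le> g x)"
proof (rule cfun_computable2[of "\<lambda>a b. 1 - (a - b)", OF _ assms])
  show "computable2 (\<lambda>a b. 1 - (a - b))"
    by (rule computable2_nat_op) (intro cfun_intros)
qed auto

lemma cfun_less [cfun_intros]:
  assumes "cfun f" "cfun g"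
  shows "cfun (\<lambda>x. (f x :: nat) < g x)"
  using cfun_le[OF cfun_Suc[OF assms(1)] assms(2)] by (simp add: Suc_le_eq)

lemma cfun_not [cfun_intros]:
  assumes "cfun f"
  shows "cfun (\<lambda>x. \<not> f x)"
proof -
  have "cfun (\<lambda>x. (of_bool (f x) :: nat) \<le> 0)" by (intro cfun_intros assms)
  then show ?thesis by simp
qed

lemma cfun_disj [cfun_intros]:
  assumes "cfun f" "cfun g"
  shows "cfun (\<lambda>x. f x \<or> g x)"
proof -
  have "cfun (\<lambda>x. 0 < of_bool (f x) + (of_bool (g x) :: nat))" by (intro cfun_intros assms)
  then show ?thesis by (rule cfun_cong) auto
qed

lemma cfun_conj [cfun_intros]:
  assumes "cfun f" "cfun g"
  shows "cfun (\<lambda>x. f x \<and> g x)"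
proof -
  have "cfun (\<lambda>x. \<not> (\<not> f x \<or> \<not> g x))" by (intro cfun_intros assms)
  then show ?thesis by simp
qed

lemma cfun_imp [cfun_intros]:
  assumes "cfun f" "cfun g"
  shows "cfun (\<lambda>x. f x \<longrightarrow> g x)"
proof -
  have "cfun (\<lambda>x. \<not> f x \<or> g x)" by (intro cfun_intros assms)
  then show ?thesis by (rule cfun_cong) blast
qed

lemma cfun_enc: "cfun f \<Longrightarrow> cfun (\<lambda>x. enc (f x))"
  by (rule cfun_comp[OF cfunI_same_code]) simp

lemma cfun_eq [cfun_intros]:
  assumes "cfun f" "cfun g"
  shows "cfun (\<lambda>x. f x = g x)"
proof -
  have "cfun (\<lambda>x. enc (f x) \<le> enc (g x) \<and> enc (g x) \<le> enc (f x))" by (intro cfun_intros cfun_enc assms)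
  then show ?thesis by (rule cfun_cong) (simp only: order_eq_iff[symmetric] enc_eq_iff)
qed

lemma cfun_rec_nat [cfun_intros]:
  assumes "cfun n" "cfun a" and "cfun (\<lambda>z. h (fst z) (fst (snd z)) (snd (snd z)))"
  shows "cfun (\<lambda>x. rec_nat (a x) (h x) (n x))"
proof -
  obtain pn pa ph where pn: "\<And>x. reval {} pn [enc x] (enc (n x))"
    and pa: "\<And>x. reval {} pa [enc x] (enc (a x))"
    and ph: "\<And>z. reval {} ph [enc z] (enc (h (fst z) (fst (snd z)) (snd (snd z))))"
    using assms unfolding cfun_def by blast
  obtain pp where pp: "\<And>xs. length xs = 2 \<Longrightarrow> reval {} pp xs (prod_encode (xs ! 0, xs ! 1))"
    using computable2_prod_encode unfolding computable2_def computable_in_def by blast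
  define g where "g = recf.Comp ph [recf.Comp pp [Proj 2, recf.Comp pp [Proj 0, Proj 1]]]"
  have g: "reval {} g [m, enc r, enc x] (enc (h x m r))" for m r x
  proof -
    have "reval {} (recf.Comp pp [Proj 0, Proj 1]) [m, enc r, enc x] (enc (m, r))"
      by (rule reval.Comp[where ys = "[m, enc r]"])
         (use reval.Proj[of 0 "[m, enc r, enc x]" "{}"] reval.Proj[of 1 "[m, enc r, enc x]" "{}"]
           pp[of "[m, enc r]"] in \<open>auto simp: less_Suc_eq\<close>)
    then have "reval {} (recf.Comp pp [Proj 2, recf.Comp pp [Proj 0, Proj 1]]) [m, enc r, enc x] (enc (x, m, r))"
      by (intro reval.Comp[where ys = "[enc x, enc (m, r)]"])
         (use reval.Proj[of 2 "[m, enc r, enc x]" "{}"] pp[of "[enc x, enc (m, r)]"] in \<open>auto simp: less_Suc_eq\<close>)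
    then show ?thesis
      unfolding g_def
      by (intro reval.Comp[where ys = "[enc (x, m, r)]"]) (use ph[of "(x, m, r)"] in auto)
  qed
  have rec: "reval {} (Prim pa g) [k, enc x] (enc (rec_nat (a x) (h x) k))" for k x
    by (induction k) (auto intro!: reval.Prim_0 reval.Prim_Suc pa g)
  have "reval {} (recf.Comp (Prim pa g) [pn, Proj 0]) [enc x] (enc (rec_nat (a x) (h x) (n x)))" for x
    by (rule reval.Comp[where ys = "[n x, enc x]"])
       (use rec[of "n x" x] pn[of x] reval.Proj[of 0 "[enc x]" "{}"] in \<open>auto simp: less_Suc_eq\<close>)
  then show ?thesis unfolding cfun_def by blast
qed

lemma cfun_if [cfun_intros]:
  assumes "cfun b" "cfun f" "cfun g"
  shows "cfun (\<lambda>x. if b x then f x else g x)"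
proof -
  have "cfun (\<lambda>x. rec_nat (g x) (\<lambda>_ _. f x) (of_bool (b x)))"
    by (intro cfun_rec_nat cfun_of_bool assms cfun_comp[OF assms(2) cfun_fst[OF cfun_id]])
  then show ?thesis by (rule cfun_cong) auto
qed

lemma cfun_case_nat [cfun_intros]:
  assumes "cfun n" "cfun f" "cfun (\<lambda>z. g (fst z) (snd z))"
  shows "cfun (\<lambda>x. case n x of 0 \<Rightarrow> f x | Suc m \<Rightarrow> g x m)"
proof -
  have "cfun (\<lambda>x. rec_nat (f x) (\<lambda>m _. g x m) (n x))"
    by (intro cfun_rec_nat assms cfun_comp[OF assms(3), of "\<lambda>z. (fst z, fst (snd z))", unfolded fst_conv snd_conv]
        cfun_intros)
  then show ?thesis by (rule cfun_cong) (simp split: nat.split)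
qed

lemma cfun_Least [cfun_intros]:
  assumes "cfun (\<lambda>z. P (fst z) (snd z))" and "\<And>x. \<exists>n. P x n"
  shows "cfun (\<lambda>x. LEAST n. P x (n::nat))"
proof -
  \<comment> \<open>\<open>Mu\<close> stops at the value 0, so the program has to decide the
    negation.\<close>
  have "cfun (\<lambda>z. \<not> P (fst z) (snd z))" by (intro cfun_intros assms)
  then obtain p where p: "\<And>z. reval {} p [enc z] (of_bool (\<not> P (fst z) (snd z)))"
    unfolding cfun_def enc_bool_def by blast
  obtain pp where pp: "\<And>xs. length xs = 2 \<Longrightarrow> reval {} pp xs (prod_encode (xs ! 0, xs ! 1))"
    using computable2_prod_encode unfolding computable2_def computable_in_def by blast
  have g: "reval {} (recf.Comp p [recf.Comp pp [Proj 1, Proj 0]]) [m, enc x] (of_bool (\<not> P x m))" for m x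
  proof -
    have "reval {} (recf.Comp pp [Proj 1, Proj 0]) [m, enc x] (enc (x, m))"
      by (rule reval.Comp[where ys = "[enc x, m]"])
         (use reval.Proj[of 0 "[m, enc x]" "{}"] reval.Proj[of 1 "[m, enc x]" "{}"]
           pp[of "[enc x, m]"] in \<open>auto simp: less_Suc_eq\<close>)
    then show ?thesis
      by (intro reval.Comp[where ys = "[enc (x, m)]"]) (use p[of "(x, m)"] in auto)
  qed
  have "reval {} (Mu (recf.Comp p [recf.Comp pp [Proj 1, Proj 0]])) [enc x] (LEAST n. P x n)" for x
  proof (rule reval.Mu)
    have "P x (LEAST n. P x n)" using assms(2) by (rule LeastI_ex)
    then show "reval {} (recf.Comp p [recf.Comp pp [Proj 1, Proj 0]]) [LEAST n. P x n, enc x] 0"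
      using g[of "LEAST n. P x n" x] by simp
    show "\<forall>m<LEAST n. P x n. \<exists>k. reval {} (recf.Comp p [recf.Comp pp [Proj 1, Proj 0]]) [m, enc x] (Suc k)"
    proof (intro allI impI)
      fix m assume "m < (LEAST n. P x n)"
      then have "\<not> P x m" by (rule not_less_Least)
      then show "\<exists>k. reval {} (recf.Comp p [recf.Comp pp [Proj 1, Proj 0]]) [m, enc x] (Suc k)"
        using g[of m x] by auto
    qed
  qed
  then show ?thesis unfolding cfun_def by auto
qed

section \<open>Lists and options\<close>

lemma cfun_Cons [cfun_intros]:
  assumes "cfun f" "cfun g"
  shows "cfun (\<lambda>x. f x # g x)"
proof (rule cfun_computable2[of "\<lambda>a b. Suc (prod_encode (a, b))", OF _ assms])
  show "computable2 (\<lambda>a b. Suc (prod_encode (a, b)))"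
    by (rule computable2_nat_op) (intro cfun_intros)
qed simp

lemma cfun_hd [cfun_intros]:
  fixes f :: "'b::enc \<Rightarrow> 'a::enc list"
  assumes "cfun f"
  shows "cfun (\<lambda>x. hd (f x))"
proof (rule cfun_comp[OF _ assms])
  \<comment> \<open>The value of \<open>hd []\<close> is unspecified but fixed, so its code can be
    built into the program.\<close>
  let ?d = "enc (hd [] :: 'a)"
  have "cfun (\<lambda>n. if n = 0 then ?d else fst (prod_decode (n - 1)))"
    by (intro cfun_intros)
  moreover have "enc (hd l) = (if enc l = 0 then ?d else fst (prod_decode (enc l - 1)))" for l :: "'a list"
    by (cases l) simp_all
  ultimately show "cfun (hd :: 'a list \<Rightarrow> 'a)"
    using cfunI cfun_nat_iff by blast
qed

lemma cfun_tl [cfun_intros]: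
  fixes f :: "'b::enc \<Rightarrow> 'a::enc list"
  assumes "cfun f"
  shows "cfun (\<lambda>x. tl (f x))"
proof (rule cfun_comp[OF _ assms])
  have "cfun (\<lambda>n. if n = 0 then 0 else snd (prod_decode (n - 1)))"
    by (intro cfun_intros)
  moreover have "enc (tl l) = (if enc l = 0 then 0 else snd (prod_decode (enc l - 1)))" for l :: "'a list"
    by (cases l) simp_all
  ultimately show "cfun (tl :: 'a list \<Rightarrow> 'a list)"
    using cfunI cfun_nat_iff by blast
qed

lemma cfun_the [cfun_intros]:
  fixes f :: "'b::enc \<Rightarrow> 'a::enc option"
  assumes "cfun f"
  shows "cfun (\<lambda>x. the (f x))"
proof (rule cfun_comp[OF _ assms])
  let ?d = "enc (the None :: 'a)"
  have "cfun (\<lambda>n. if n = 0 then ?d else n - 1)"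
    by (intro cfun_intros)
  moreover have "enc (the l) = (if enc l = 0 then ?d else enc l - 1)" for l :: "'a option"
    by (cases l) simp_all
  ultimately show "cfun (the :: 'a option \<Rightarrow> 'a)"
    using cfunI cfun_nat_iff by blast
qed

lemma cfun_Some [cfun_intros]: "cfun f \<Longrightarrow> cfun (\<lambda>x. Some (f x))"
  by (rule cfun_comp[of Some], rule cfunI[OF computable1_Suc]) simp_all

lemma cfun_case_list [cfun_intros]:
  assumes "cfun l" "cfun f" "cfun (\<lambda>z. g (fst z) (fst (snd z)) (snd (snd z)))"
  shows "cfun (\<lambda>x. case l x of [] \<Rightarrow> f x | y # ys \<Rightarrow> g x y ys)"
proof -
  have "cfun (\<lambda>x. if l x = [] then f x else g x (hd (l x)) (tl (l x)))"
    by (intro cfun_if cfun_eq assms cfun_const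
        cfun_comp[OF assms(3), of "\<lambda>x. (x, hd (l x), tl (l x))", unfolded fst_conv snd_conv] cfun_Pair cfun_id
        cfun_hd cfun_tl)
  then show ?thesis by (rule cfun_cong) (simp split: list.split)
qed

lemma cfun_case_option [cfun_intros]:
  assumes "cfun l" "cfun f" "cfun (\<lambda>z. g (fst z) (snd z))"
  shows "cfun (\<lambda>x. case l x of None \<Rightarrow> f x | Some y \<Rightarrow> g x y)"
proof -
  have "cfun (\<lambda>x. if l x = None then f x else g x (the (l x)))"
    by (intro cfun_if cfun_eq assms cfun_const
        cfun_comp[OF assms(3), of "\<lambda>x. (x, the (l x))", unfolded fst_conv snd_conv] cfun_Pair cfun_id cfun_the)
  then show ?thesis by (rule cfun_cong) (simp split: option.split)
qed

lemma length_le_enc: "length l \<le> enc l"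
proof (induction l)
  case (Cons a l)
  then show ?case using le_prod_encode_2[of "enc l" "enc a"] by simp
qed simp

text \<open>The number of rounds has to be read off the code: \<open>enc (l x)\<close> bounds the
  length of the list, and surplus rounds change nothing once the list is used up.\<close>

lemma cfun_foldl [cfun_intros]:
  assumes "cfun l" "cfun a" "cfun (\<lambda>z. h (fst z) (fst (snd z)) (snd (snd z)))"
  shows "cfun (\<lambda>x. foldl (h x) (a x) (l x))"
proof -
  let ?step = "\<lambda>x s. if fst s = [] then s else (tl (fst s), h x (snd s) (hd (fst s)))"
  have h: "cfun (\<lambda>z. h (F z) (G z) (H z))" if "cfun F" "cfun G" "cfun H" for F G H
    using cfun_comp[OF assms(3), of "\<lambda>z. (F z, G z, H z)"] that by (simp add: cfun_Pair)
  have "cfun (\<lambda>x. snd (rec_nat (l x, a x) (\<lambda>_. ?step x) (enc (l x))))"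
    by (intro cfun_snd cfun_fst cfun_rec_nat cfun_Pair cfun_enc assms(1,2) cfun_if cfun_eq cfun_const
        cfun_tl cfun_hd cfun_id h)
  moreover have "snd (rec_nat (ys, b) (\<lambda>_. ?step x) n) = foldl (h x) b ys" if "length ys \<le> n" for x ys b n
  proof -
    have "rec_nat (ys, b) (\<lambda>_. ?step x) n = (drop n ys, foldl (h x) b (take n ys))" for n
    proof (induction n)
      case (Suc n)
      then show ?case
        by (cases "n < length ys") (auto simp: take_Suc_conv_app_nth hd_drop_conv_nth drop_Suc tl_drop)
    qed simp
    with that show ?thesis by simp
  qed
  ultimately show ?thesis by (rule cfun_cong) (simp add: length_le_enc)
qed

lemma cfun_rev [cfun_intros]:
  fixes l :: "'b::enc \<Rightarrow> 'a::enc list"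
  assumes "cfun l"
  shows "cfun (\<lambda>x. rev (l x))"
proof (rule cfun_comp[OF _ assms])
  have "cfun (\<lambda>l :: 'a list. foldl (\<lambda>acc y. y # acc) [] l)" by (intro cfun_intros)
  moreover have "foldl (\<lambda>acc y. y # acc) ys l = rev l @ ys" for l ys :: "'a list"
    by (induction l arbitrary: ys) auto
  ultimately show "cfun (rev :: 'a list \<Rightarrow> 'a list)" by simp
qed

lemma cfun_append [cfun_intros]:
  assumes "cfun l" "cfun k"
  shows "cfun (\<lambda>x. l x @ k x)"
proof -
  have "cfun (\<lambda>x. foldl (\<lambda>acc y. y # acc) (k x) (rev (l x)))"
    by (intro cfun_foldl cfun_rev assms cfun_Cons cfun_fst cfun_snd cfun_id)
  moreover have "foldl (\<lambda>acc y. y # acc) ys (rev l) = l @ ys" for l ys :: "'b list"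
    by (induction l arbitrary: ys) auto
  ultimately show ?thesis by simp
qed

lemma cfun_map [cfun_intros]:
  assumes "cfun l" "cfun (\<lambda>z. f (fst z) (snd z))"
  shows "cfun (\<lambda>x. map (f x) (l x))"
proof -
  have "cfun (\<lambda>x. rev (foldl (\<lambda>acc y. f x y # acc) [] (l x)))"
    by (intro cfun_foldl cfun_rev assms(1) cfun_Cons cfun_fst cfun_snd cfun_id cfun_const
        cfun_comp[OF assms(2), of "\<lambda>z. (fst z, snd (snd z))", unfolded fst_conv snd_conv] cfun_Pair)
  moreover have "foldl (\<lambda>acc y. f x y # acc) ys l = rev (map (f x) l) @ ys" for x l ys
    by (induction l arbitrary: ys) auto
  ultimately show ?thesis by simp
qed

lemma cfun_length [cfun_intros]:
  assumes "cfun l"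
  shows "cfun (\<lambda>x. length (l x))"
proof -
  have "cfun (\<lambda>x. foldl (\<lambda>n _. Suc n) 0 (l x))" by (intro cfun_intros assms)
  moreover have "foldl (\<lambda>n _. Suc n) k l = length l + k" for k and l :: "'b list"
    by (induction l arbitrary: k) auto
  ultimately show ?thesis by simp
qed

lemma cfun_list_all [cfun_intros]:
  assumes "cfun l" "cfun (\<lambda>z. P (fst z) (snd z))"
  shows "cfun (\<lambda>x. list_all (P x) (l x))"
proof -
  have "cfun (\<lambda>x. foldl (\<lambda>b y. b \<and> P x y) True (l x))"
    by (intro cfun_foldl assms(1) cfun_conj cfun_fst cfun_snd cfun_id cfun_const
        cfun_comp[OF assms(2), of "\<lambda>z. (fst z, snd (snd z))", unfolded fst_conv snd_conv] cfun_Pair)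
  moreover have "foldl (\<lambda>b y. b \<and> P x y) b l \<longleftrightarrow> b \<and> list_all (P x) l" for x b l
    by (induction l arbitrary: b) auto
  ultimately show ?thesis by simp
qed

lemma cfun_list_ex [cfun_intros]:
  assumes "cfun l" "cfun (\<lambda>z. P (fst z) (snd z))"
  shows "cfun (\<lambda>x. list_ex (P x) (l x))"
proof -
  have "cfun (\<lambda>x. \<not> list_all (\<lambda>y. \<not> P x y) (l x))" by (intro cfun_intros assms)
  then show ?thesis by (rule cfun_cong) (simp add: list_all_iff list_ex_iff)
qed

lemma cfun_upt [cfun_intros]:
  assumes "cfun n"
  shows "cfun (\<lambda>x. [0..<n x])"
proof -
  have "cfun (\<lambda>x. rec_nat [] (\<lambda>m r. r @ [m]) (n x))" by (intro cfun_intros assms)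
  moreover have "rec_nat [] (\<lambda>m r. r @ [m]) n = [0..<n]" for n
    by (induction n) auto
  ultimately show ?thesis by simp
qed

lemma cfun_drop [cfun_intros]:
  assumes "cfun n" "cfun l"
  shows "cfun (\<lambda>x. drop (n x) (l x))"
proof -
  have "cfun (\<lambda>x. rec_nat (l x) (\<lambda>_. tl) (n x))" by (intro cfun_intros assms)
  moreover have "rec_nat l (\<lambda>_. tl) n = drop n l" for n and l :: "'b list"
    by (induction n) (auto simp: drop_Suc tl_drop)
  ultimately show ?thesis by simp
qed

lemma cfun_nth_default [cfun_intros]:
  assumes "cfun d" "cfun l" "cfun i"
  shows "cfun (\<lambda>x. nth_default (d x) (l x) (i x))"
proof -
  have "cfun (\<lambda>x. if i x < length (l x) then hd (drop (i x) (l x)) else d x)"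
    by (intro cfun_intros assms)
  then show ?thesis by (rule cfun_cong) (simp add: nth_default_def hd_drop_conv_nth)
qed

lemma cfun_power [cfun_intros]:
  assumes "cfun f" "cfun g"
  shows "cfun (\<lambda>x. (f x :: nat) ^ g x)"
proof -
  have "cfun (\<lambda>x. rec_nat 1 (\<lambda>_ r. f x * r) (g x))"
    by (intro cfun_intros assms cfun_comp[OF assms(1) cfun_fst[OF cfun_id]])
  moreover have "rec_nat 1 (\<lambda>_ r. b * r) n = b ^ n" for b n :: nat
    by (induction n) auto
  ultimately show ?thesis by simp
qed

text \<open>The easy half of the limit lemma: for a convergent approximation, holding from some
  stage on is the same as holding at arbitrarily late stages.\<close>

lemma delta02_limit:
  assumes "cfun (\<lambda>z. P (fst z) (snd z))" and "\<And>x. \<forall>\<^sub>F t in sequentially. P t x \<longleftrightarrow> x \<in> Y"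
  shows "delta02 Y"
proof -
  have P: "cfun (\<lambda>z. P (f z) (g z))" if "cfun f" "cfun g" for f g :: "'a::enc \<Rightarrow> nat"
    using cfun_comp[OF assms(1) cfun_Pair[OF that]] by simp
  have lim: "\<exists>s. \<forall>t\<ge>s. P t x \<longleftrightarrow> x \<in> Y" for x
    using assms(2) unfolding eventually_sequentially by blast
  have "sigma02 Y" unfolding sigma02_def
  proof (intro exI conjI)
    show "computable3 (\<lambda>x y z. of_bool (y \<le> z \<longrightarrow> P z x))"
      by (intro computable3_nat_op cfun_intros P)
    show "Y = {x. \<exists>y. \<forall>z. y \<le> z \<longrightarrow> P z x}"
    proof (intro set_eqI iffI CollectI)
      fix x assume "x \<in> {x. \<exists>y. \<forall>z. y \<le> z \<longrightarrow> P z x}"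
      then obtain y where y: "\<And>z. y \<le> z \<Longrightarrow> P z x" by blast
      obtain s where "\<forall>t\<ge>s. P t x \<longleftrightarrow> x \<in> Y" using lim by blast
      with y[of "max y s"] show "x \<in> Y" by simp
    next
      fix x assume "x \<in> Y"
      with lim[of x] show "\<exists>y. \<forall>z. y \<le> z \<longrightarrow> P z x" by blast
    qed
  qed
  moreover have "pi02 Y" unfolding pi02_def
  proof (intro exI conjI)
    show "computable3 (\<lambda>x y z. of_bool (y \<le> z \<and> P z x))"
      by (intro computable3_nat_op cfun_intros P)
    show "Y = {x. \<forall>y. \<exists>z. y \<le> z \<and> P z x}"
    proof (intro set_eqI iffI CollectI allI)
      fix x y assume "x \<in> Y"
      with lim[of x] obtain s where "\<forall>t\<ge>s. P t x" by blast
      then show "\<exists>z. y \<le> z \<and> P z x" by (intro exI[of _ "max y s"]) simp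
    next
      fix x assume "x \<in> {x. \<forall>y. \<exists>z. y \<le> z \<and> P z x}"
      with lim[of x] show "x \<in> Y" by blast
    qed
  qed
  ultimately show ?thesis unfolding delta02_def ..
qed

section \<open>Step-bounded evaluation with a finite oracle\<close>

text \<open>
  Values are shifted by one, so that \<open>0\<close> stands for an undefined value. The function \<open>F\<close> supplies the
  values of the recursive calls.
\<close>

definition ev_step :: "bool list \<Rightarrow> nat \<Rightarrow> (nat \<Rightarrow> nat list \<Rightarrow> nat) \<Rightarrow> nat \<Rightarrow> nat list \<Rightarrow> nat" where
  "ev_step \<tau> n F p xs =
    (let tag = fst (prod_decode p); q = snd (prod_decode p);
         a = fst (prod_decode q); b = snd (prod_decode q)
     in if tag = 0 then 1
     else if tag = 1 then (case xs of [] \<Rightarrow> 0 | x # ys \<Rightarrow> Suc (Suc x))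
     else if tag = 2 then (if q < length xs then Suc (nth_default 0 xs q) else 0)
     else if tag = 3 then (case xs of [] \<Rightarrow> 0 | x # ys \<Rightarrow>
       if x < length \<tau> then Suc (of_bool (nth_default False \<tau> x)) else 0)
     else if tag = 4 then
       (if list_ex (\<lambda>g. F g xs = 0) (list_decode b) then 0
        else F a (map (\<lambda>g. F g xs - 1) (list_decode b)))
     else if tag = 5 then (case xs of [] \<Rightarrow> 0 | x # ys \<Rightarrow>
       (case x of 0 \<Rightarrow> F a ys | Suc m \<Rightarrow>
         if F p (m # ys) = 0 then 0 else F b (m # (F p (m # ys) - 1) # ys)))
     else (let m = LEAST m. n \<le> m \<or> F q (m # xs) < 2 in
       if m < n \<and> F q (m # xs) = 1 then Suc m else 0))"

definition lookup :: "nat list \<Rightarrow> nat \<Rightarrow> nat list \<Rightarrow> nat" where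
  "lookup D p xs = nth_default 0 D (prod_encode (p, list_encode xs))"

text \<open>The nested recursion over programs becomes a single recursion over stages on finite
  data: the table for \<open>Suc m\<close> is computed from the one for \<open>m\<close> and has
  room for the calls with code below \<open>m\<close> only.\<close>

definition ev_table :: "bool list \<Rightarrow> nat \<Rightarrow> nat list" where
  "ev_table \<tau> n = rec_nat [] (\<lambda>m D. map (\<lambda>j.
    ev_step \<tau> m (lookup D) (fst (prod_decode j)) (list_decode (snd (prod_decode j)))) [0..<m]) n"

definition eval_upto :: "bool list \<Rightarrow> nat \<Rightarrow> nat \<Rightarrow> nat list \<Rightarrow> nat" where
  "eval_upto \<tau> n p xs = lookup (ev_table \<tau> n) p xs"

lemma eval_upto_0 [simp]: "eval_upto \<tau> 0 p xs = 0"
  by (simp add: eval_upto_def ev_table_def lookup_def)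

lemma eval_upto_Suc:
  "eval_upto \<tau> (Suc n) p xs =
    (if prod_encode (p, list_encode xs) < n then ev_step \<tau> n (eval_upto \<tau> n) p xs else 0)"
proof -
  have "eval_upto \<tau> n = lookup (ev_table \<tau> n)" by (simp add: fun_eq_iff eval_upto_def)
  then show ?thesis
    by (simp add: eval_upto_def[of \<tau> "Suc n"] lookup_def[of "ev_table \<tau> (Suc n)"] nth_default_def)
       (simp add: ev_table_def)
qed

lemma cfun_ev_step:
  "cfun (\<lambda>(z :: bool list \<times> nat \<times> nat list \<times> nat \<times> nat list).
    ev_step (fst z) (fst (snd z)) (lookup (fst (snd (snd z)))) (fst (snd (snd (snd z)))) (snd (snd (snd (snd z)))))"
  unfolding ev_step_def Let_def lookup_def
  by (intro cfun_intros) auto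

lemma cfun_eval_upto [cfun_intros]:
  assumes "cfun \<tau>" "cfun n" "cfun p" "cfun xs"
  shows "cfun (\<lambda>x. eval_upto (\<tau> x) (n x) (p x) (xs x))"
proof -
  have step: "cfun (\<lambda>x. ev_step (\<tau> x) (n x) (lookup (D x)) (p x) (xs x))"
    if "cfun \<tau>" "cfun n" "cfun D" "cfun p" "cfun xs" for \<tau> n D p and xs :: "'b::enc \<Rightarrow> nat list"
    using cfun_comp[OF cfun_ev_step, of "\<lambda>x. (\<tau> x, n x, D x, p x, xs x)"] that
    by (simp add: cfun_Pair)
  have "cfun (\<lambda>z :: bool list \<times> nat. ev_table (fst z) (snd z))"
    unfolding ev_table_def by (intro cfun_intros step)
  from cfun_comp[OF this, of "\<lambda>x. (\<tau> x, n x)"] have "cfun (\<lambda>x. ev_table (\<tau> x) (n x))"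
    using assms by (simp add: cfun_Pair)
  then show ?thesis
    unfolding eval_upto_def lookup_def by (intro cfun_intros assms)
qed

lemma ev_step_mono:
  assumes def: "ev_step \<tau> n F p xs \<noteq> 0" and "prefix \<tau> \<tau>'" "n \<le> n'"
    and F: "\<And>p xs. F p xs \<noteq> 0 \<Longrightarrow> F' p xs = F p xs"
  shows "ev_step \<tau>' n' F' p xs = ev_step \<tau> n F p xs"
proof -
  define tag q where "tag = fst (prod_decode p)" and "q = snd (prod_decode p)"
  define a b where "a = fst (prod_decode q)" and "b = snd (prod_decode q)"
  note ev = ev_step_def[of _ _ _ p xs, unfolded Let_def, folded tag_def q_def, folded a_def b_def]
  have nth: "x < length \<tau>' \<and> nth_default False \<tau>' x = nth_default False \<tau> x" if "x < length \<tau>" for x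
    using that \<open>prefix \<tau> \<tau>'\<close> by (auto simp: prefix_def nth_default_def nth_append)
  consider "tag < 3" | "tag = 3" | "tag = 4" | "tag = 5" | "tag > 5" by linarith
  then show ?thesis
  proof cases
    case 1
    then show ?thesis by (auto simp: ev split: list.split)
  next
    case 2
    then show ?thesis using def by (auto simp: ev nth split: if_splits list.splits)
  next
    case 3
    from def have nz: "\<And>g. g \<in> set (list_decode b) \<Longrightarrow> F g xs \<noteq> 0" and out: "F a (map (\<lambda>g. F g xs - 1) (list_decode b)) \<noteq> 0"
      by (auto simp: ev 3 list_ex_iff split: if_splits)
    from nz have "map (\<lambda>g. F' g xs - 1) (list_decode b) = map (\<lambda>g. F g xs - 1) (list_decode b)"
      by (simp add: F)
    with F[OF out] have "F' a (map (\<lambda>g. F' g xs - 1) (list_decode b)) = F a (map (\<lambda>g. F g xs - 1) (list_decode b))"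
      by (simp only:)
    with nz show ?thesis by (auto simp: ev 3 F list_ex_iff dest: nz)
  next
    case 4
    then show ?thesis using def F by (auto simp: ev split: if_splits list.splits nat.splits)
  next
    case 5
    \<comment> \<open>A value below 2 is either undefined or the output 0. Since the search
      succeeded, the values before \<open>m\<close> were defined and nonzero as outputs; they
      persist, so the longer search stops at the same place.\<close>
    define m where "m = (LEAST m. n \<le> m \<or> F q (m # xs) < 2)"
    have m: "m < n" "F q (m # xs) = 1"
      using def 5 by (auto simp: ev m_def split: if_splits)
    have "2 \<le> F q (i # xs)" if "i < m" for i
      using not_less_Least[of i "\<lambda>m. n \<le> m \<or> F q (m # xs) < 2"] that unfolding m_def by simp
    then have low: "2 \<le> F' q (i # xs)" if "i < m" for i
      using F[of q "i # xs"] that by force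
    have m': "F' q (m # xs) = 1"
      using F[of q "m # xs"] m by simp
    have "(LEAST m. n' \<le> m \<or> F' q (m # xs) < 2) = m"
    proof (rule Least_equality)
      show "m \<le> y" if "n' \<le> y \<or> F' q (y # xs) < 2" for y
        using that m low[of y] \<open>n \<le> n'\<close> by (cases "y < m") auto
    qed (simp add: m')
    then show ?thesis using m m' \<open>n \<le> n'\<close> 5 by (simp add: ev m_def[symmetric])
  qed
qed

lemma eval_upto_mono:
  assumes "eval_upto \<tau> n p xs \<noteq> 0" "prefix \<tau> \<tau>'" "n \<le> n'"
  shows "eval_upto \<tau>' n' p xs = eval_upto \<tau> n p xs"
  using assms(1,3)
proof (induction n arbitrary: n' p xs)
  case (Suc n)
  from Suc.prems obtain k where k: "n' = Suc k" "n \<le> k" by (auto simp: Suc_le_D Suc_le_eq gr0_conv_Suc dest!: less_imp_Suc_add)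
  from Suc.prems have "prod_encode (p, list_encode xs) < n" "ev_step \<tau> n (eval_upto \<tau> n) p xs \<noteq> 0"
    by (auto simp: eval_upto_Suc split: if_splits)
  with k ev_step_mono[OF this(2) assms(2) k(2), of "eval_upto \<tau>' k"] Suc.IH[OF _ k(2)] show ?case
    by (simp add: eval_upto_Suc)
qed simp

text \<open>The tags match the cases of \<open>ev_step\<close>. There every number acts as a
  program, so that requirements can be indexed by all numbers.\<close>

fun rcode :: "recf \<Rightarrow> nat" where
  "rcode Zero = prod_encode (0, 0)"
| "rcode Succ = prod_encode (1, 0)"
| "rcode (Proj i) = prod_encode (2, i)"
| "rcode Oracle = prod_encode (3, 0)"
| "rcode (recf.Comp f gs) = prod_encode (4, prod_encode (rcode f, list_encode (map rcode gs)))"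
| "rcode (Prim f g) = prod_encode (5, prod_encode (rcode f, rcode g))"
| "rcode (Mu f) = prod_encode (6, rcode f)"

lemma ev_step_rcode:
  "ev_step \<tau> n F (rcode Zero) xs = 1"
  "ev_step \<tau> n F (rcode Succ) xs = (case xs of [] \<Rightarrow> 0 | x # ys \<Rightarrow> Suc (Suc x))"
  "ev_step \<tau> n F (rcode (Proj i)) xs = (if i < length xs then Suc (xs ! i) else 0)"
  "ev_step \<tau> n F (rcode Oracle) xs =
    (case xs of [] \<Rightarrow> 0 | x # ys \<Rightarrow> if x < length \<tau> then Suc (of_bool (\<tau> ! x)) else 0)"
  "ev_step \<tau> n F (rcode (recf.Comp f gs)) xs =
    (if \<exists>g\<in>set gs. F (rcode g) xs = 0 then 0 else F (rcode f) (map (\<lambda>g. F (rcode g) xs - 1) gs))"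
  "ev_step \<tau> n F (rcode (Prim f g)) xs = (case xs of [] \<Rightarrow> 0 | x # ys \<Rightarrow> (case x of 0 \<Rightarrow> F (rcode f) ys
    | Suc m \<Rightarrow> let r = F (rcode (Prim f g)) (m # ys) in
        if r = 0 then 0 else F (rcode g) (m # (r - 1) # ys)))"
  "ev_step \<tau> n F (rcode (Mu f)) xs = (let m = LEAST m. n \<le> m \<or> F (rcode f) (m # xs) < 2 in
    if m < n \<and> F (rcode f) (m # xs) = 1 then Suc m else 0)"
  by (auto simp: ev_step_def Let_def nth_default_def list_ex_iff comp_def split: list.split nat.split)

lemma eval_upto_sound:
  assumes "eval_upto \<tau> n (rcode p) xs = Suc y" and "\<And>i. i < length \<tau> \<Longrightarrow> \<tau> ! i \<longleftrightarrow> i \<in> X"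
  shows "reval X p xs y"
  using assms(1)
proof (induction n arbitrary: p xs y)
  case (Suc n)
  let ?F = "eval_upto \<tau> n"
  from Suc.prems have ev: "ev_step \<tau> n ?F (rcode p) xs = Suc y"
    by (simp add: eval_upto_Suc split: if_splits)
  show ?case
  proof (cases p)
    case Zero
    with ev show ?thesis by (simp add: ev_step_rcode del: rcode.simps) (auto intro: reval.Zero)
  next
    case Succ
    with ev show ?thesis by (auto simp: ev_step_rcode simp del: rcode.simps split: list.splits intro: reval.Succ)
  next
    case (Proj i)
    with ev show ?thesis by (auto simp: ev_step_rcode simp del: rcode.simps split: if_splits intro: reval.Proj)
  next
    case Oracle
    with ev assms(2) show ?thesis
      by (auto simp: ev_step_rcode simp del: rcode.simps split: list.splits if_splits intro: reval.Oracle)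
  next
    case (Comp f gs)
    with ev have nz: "\<And>g. g \<in> set gs \<Longrightarrow> ?F (rcode g) xs \<noteq> 0"
      and f: "?F (rcode f) (map (\<lambda>g. ?F (rcode g) xs - 1) gs) = Suc y"
      by (auto simp: ev_step_rcode simp del: rcode.simps split: if_splits)
    show ?thesis unfolding Comp
    proof (rule reval.Comp)
      show "\<forall>i<length gs. reval X (gs ! i) xs (map (\<lambda>g. ?F (rcode g) xs - 1) gs ! i)"
        using nz by (auto intro!: Suc.IH)
      show "reval X f (map (\<lambda>g. ?F (rcode g) xs - 1) gs) y"
        by (rule Suc.IH[OF f])
    qed simp
  next
    case (Prim f g)
    from ev Prim obtain x ys where xs: "xs = x # ys"
      by (cases xs) (auto simp: ev_step_rcode simp del: rcode.simps)
    show ?thesis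
    proof (cases x)
      case 0
      with ev Prim xs have "?F (rcode f) ys = Suc y"
        by (simp add: ev_step_rcode del: rcode.simps)
      with Prim xs 0 Suc.IH show ?thesis by (auto intro: reval.Prim_0)
    next
      case (Suc m)
      obtain r where "?F (rcode (Prim f g)) (m # ys) = Suc r" "?F (rcode g) (m # r # ys) = Suc y"
        using ev Prim xs Suc
        by (cases "?F (rcode (Prim f g)) (m # ys)") (auto simp: ev_step_rcode simp del: rcode.simps)
      from this[THEN Suc.IH] show ?thesis unfolding Prim xs Suc by (rule reval.Prim_Suc)
    qed
  next
    case (Mu f)
    define m where "m = (LEAST m. n \<le> m \<or> ?F (rcode f) (m # xs) < 2)"
    have m: "m < n" "?F (rcode f) (m # xs) = 1" "y = m"
      using ev Mu by (auto simp: ev_step_rcode m_def[symmetric] Let_def simp del: rcode.simps split: if_splits)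
    have "\<exists>k. ?F (rcode f) (i # xs) = Suc (Suc k)" if "i < m" for i
    proof -
      have "2 \<le> ?F (rcode f) (i # xs)"
        using not_less_Least[of i "\<lambda>m. n \<le> m \<or> ?F (rcode f) (m # xs) < 2"] that unfolding m_def by simp
      then show ?thesis by presburger
    qed
    with Suc.IH have "\<forall>i<m. \<exists>k. reval X f (i # xs) (Suc k)" by blast
    moreover have "reval X f (m # xs) 0" using m by (intro Suc.IH) simp
    ultimately show ?thesis unfolding Mu \<open>y = m\<close> by (intro reval.Mu)
  qed
qed simp

lemma length_restrict [simp]: "length (restrict X n) = n"
  by (simp add: restrict_def)

lemma nth_restrict [simp]: "i < n \<Longrightarrow> restrict X n ! i \<longleftrightarrow> i \<in> X"
  by (simp add: restrict_def)

lemma take_restrict: "n \<le> m \<Longrightarrow> take n (restrict X m) = restrict X n"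
  by (auto intro: nth_equalityI)

lemma prefix_restrict: "n \<le> m \<Longrightarrow> prefix (restrict X n) (restrict X m)"
  by (metis take_restrict take_is_prefix)

lemma restrict_empty: "restrict {} t = replicate t False"
  by (simp add: restrict_def map_replicate_const)

text \<open>By \<open>eval_upto_mono\<close> one defined value suffices. The stage is taken beyond
  the code of the call, so that the table has room for it.\<close>

lemma eventually_eval_uptoI:
  assumes "\<forall>\<^sub>F n in sequentially.
    ev_step (restrict X n) n (eval_upto (restrict X n) n) p xs = Suc y"
  shows "\<forall>\<^sub>F n in sequentially. eval_upto (restrict X n) n p xs = Suc y"
proof -
  obtain N where N: "\<And>n. N \<le> n \<Longrightarrow> ev_step (restrict X n) n (eval_upto (restrict X n) n) p xs = Suc y"
    using assms unfolding eventually_sequentially by blast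
  define n where "n = max N (Suc (prod_encode (p, list_encode xs)))"
  have n: "eval_upto (restrict X n) (Suc n) p xs = Suc y"
    using N[of n] by (simp add: eval_upto_Suc n_def less_max_iff_disj)
  have "eval_upto (restrict X m) m p xs = Suc y" if "Suc n \<le> m" for m
    using eval_upto_mono[of "restrict X n" "Suc n" p xs "restrict X m" m] n prefix_restrict[of n m X] that
    by simp
  then show ?thesis unfolding eventually_sequentially by blast
qed

lemma eventually_eval_upto:
  assumes "reval X p xs y"
  shows "\<forall>\<^sub>F n in sequentially. eval_upto (restrict X n) n (rcode p) xs = Suc y"
  using assms
proof (induction rule: reval.induct)
  case (Zero xs)
  show ?case by (rule eventually_eval_uptoI) (simp add: ev_step_rcode del: rcode.simps)
next
  case (Succ x xs)
  show ?case by (rule eventually_eval_uptoI) (simp add: ev_step_rcode del: rcode.simps)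
next
  case (Proj i xs)
  then show ?case by (intro eventually_eval_uptoI) (simp add: ev_step_rcode del: rcode.simps)
next
  case (Oracle x xs)
  show ?case
    by (rule eventually_eval_uptoI, rule eventually_mono[OF eventually_gt_at_top[of x]])
       (simp add: ev_step_rcode del: rcode.simps)
next
  case (Comp ys gs xs f z)
  have "\<forall>\<^sub>F n in sequentially. \<forall>i\<in>{..<length gs}. eval_upto (restrict X n) n (rcode (gs ! i)) xs = Suc (ys ! i)"
    using Comp.IH by (intro eventually_ball_finite) auto
  with Comp.IH(2) show ?case
  proof (intro eventually_eval_uptoI, eventually_elim)
    case (elim n)
    then have "map (\<lambda>g. eval_upto (restrict X n) n (rcode g) xs - 1) gs = ys"
      using Comp.hyps by (intro nth_equalityI) auto
    moreover have "\<forall>g\<in>set gs. eval_upto (restrict X n) n (rcode g) xs \<noteq> 0"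
      using elim by (auto simp: in_set_conv_nth)
    ultimately show ?case using elim by (simp add: ev_step_rcode del: rcode.simps)
  qed
next
  case (Prim_0 f xs y g)
  then show ?case
    by (intro eventually_eval_uptoI) (auto elim!: eventually_mono simp: ev_step_rcode simp del: rcode.simps)
next
  case (Prim_Suc f g n xs r y)
  from Prim_Suc.IH show ?case
    by (intro eventually_eval_uptoI, eventually_elim) (simp add: ev_step_rcode del: rcode.simps)
next
  case (Mu f m xs)
  have "\<forall>\<^sub>F n in sequentially. \<forall>i\<in>{..<m}. \<exists>k. eval_upto (restrict X n) n (rcode f) (i # xs) = Suc (Suc k)"
    using Mu.IH(2) by (intro eventually_ball_finite ballI) (fastforce elim: eventually_mono)+
  with Mu.IH(1) eventually_gt_at_top[of m] show ?case
  proof (intro eventually_eval_uptoI, eventually_elim)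
    case (elim n)
    then have "(LEAST m. n \<le> m \<or> eval_upto (restrict X n) n (rcode f) (m # xs) < 2) = m"
      by (intro Least_equality) (auto, metis lessThan_iff not_less less_2_cases_iff nat.inject One_nat_def nat.distinct(1) not_less_eq)
    with elim show ?case by (simp add: ev_step_rcode del: rcode.simps)
  qed
qed

definition eval_string :: "bool list \<Rightarrow> nat \<Rightarrow> nat \<Rightarrow> nat" where
  "eval_string \<tau> p x = eval_upto \<tau> (length \<tau>) p [x]"

lemma cfun_eval_string [cfun_intros]:
  "cfun \<tau> \<Longrightarrow> cfun p \<Longrightarrow> cfun x \<Longrightarrow> cfun (\<lambda>z. eval_string (\<tau> z) (p z) (x z))"
  unfolding eval_string_def by (intro cfun_intros)

lemma eval_string_mono:
  "eval_string \<tau> p x \<noteq> 0 \<Longrightarrow> prefix \<tau> \<tau>' \<Longrightarrow> eval_string \<tau>' p x = eval_string \<tau> p x"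
  unfolding eval_string_def by (rule eval_upto_mono) (auto dest: prefix_length_le)

text \<open>The table has no room for larger arguments. This keeps the set enumerated by a given
  stage finite.\<close>

lemma eval_string_bound:
  assumes "eval_string \<tau> p x \<noteq> 0"
  shows "x < length \<tau>"
proof -
  obtain n where n: "length \<tau> = Suc n" "prod_encode (p, list_encode [x]) < n"
    using assms by (cases "length \<tau>") (auto simp: eval_string_def eval_upto_Suc split: if_splits)
  have "x \<le> list_encode [x]"
    using le_prod_encode_1[of x 0] by simp
  also have "\<dots> \<le> prod_encode (p, list_encode [x])"
    by (rule le_prod_encode_2)
  finally show ?thesis using n by simp
qed

lemma eval_string_sound:
  "eval_string (restrict X n) (rcode p) x = Suc y \<Longrightarrow> reval X p [x] y"
  unfolding eval_string_def by (rule eval_upto_sound) auto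

lemma eventually_eval_string:
  "reval X p [x] y \<Longrightarrow> \<forall>\<^sub>F n in sequentially. eval_string (restrict X n) (rcode p) x = Suc y"
  unfolding eval_string_def by (drule eventually_eval_upto) simp

section \<open>Auxiliary facts on sums, pairs and sequences\<close>

lemma mono_bounded_nat_eventually_const:
  fixes f :: "nat \<Rightarrow> nat"
  assumes "mono f" and "\<And>t. f t \<le> B"
  shows "\<exists>l. \<forall>\<^sub>F t in sequentially. f t = l"
proof -
  have fin: "finite (range f)"
    by (rule finite_subset[of _ "{..B}"]) (use assms(2) in auto)
  then have "Max (range f) \<in> range f" by (intro Max_in) auto
  then obtain s where s: "f s = Max (range f)" by (metis rangeE)
  have "f t = Max (range f)" if "s \<le> t" for t
    using monoD[OF assms(1) that] s Max_ge[OF fin, of "f t"] by simp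
  then show ?thesis unfolding eventually_sequentially by blast
qed

lemma sum_half_powers_le:
  assumes "finite B"
  shows "(\<Sum>b\<in>B. (1/2 :: real) ^ b) \<le> 2"
proof -
  have "(\<Sum>b\<in>B. (1/2 :: real) ^ b) \<le> (\<Sum>b. (1/2) ^ b)"
    by (intro sum_le_suminf assms) (auto intro: summable_geometric)
  also have "\<dots> = 2" by (subst suminf_geometric) auto
  finally show ?thesis .
qed

text \<open>A Kraft-type inequality: a summand is the probability of its vector when the coordinates
  are independent and take the value \<open>v\<close> with probability \<open>(1/2) ^ Suc v\<close>.
  The induction splits the vectors by their last coordinate.\<close>

lemma sum_distinct_vectors_le:
  fixes u :: "'a \<Rightarrow> nat \<Rightarrow> nat"
  assumes "finite J" and "\<And>I I'. I \<in> J \<Longrightarrow> I' \<in> J \<Longrightarrow> I \<noteq> I' \<Longrightarrow> \<exists>m<n. u I m \<noteq> u I' m"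
  shows "(\<Sum>I\<in>J. \<Prod>m<n. (1/2 :: real) ^ Suc (u I m)) \<le> 1"
  using assms
proof (induction n arbitrary: J)
  case 0
  then have "\<And>I I'. I \<in> J \<Longrightarrow> I' \<in> J \<Longrightarrow> I = I'" by blast
  then have "card J \<le> 1" using "0.prems"(1) by (auto simp: card_le_Suc0_iff_eq)
  then show ?case by simp
next
  case (Suc n)
  let ?P = "\<lambda>I. \<Prod>m<n. (1/2 :: real) ^ Suc (u I m)"
  have "(\<Sum>I\<in>J. \<Prod>m<Suc n. (1/2 :: real) ^ Suc (u I m)) =
      (\<Sum>v\<in>(\<lambda>I. u I n) ` J. \<Sum>I\<in>{I\<in>J. u I n = v}. ?P I * (1/2) ^ Suc (u I n))"
    by (subst sum.image_gen[OF Suc.prems(1), of _ "\<lambda>I. u I n"]) simp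
  also have "\<dots> = (\<Sum>v\<in>(\<lambda>I. u I n) ` J. (1/2) ^ Suc v * (\<Sum>I\<in>{I\<in>J. u I n = v}. ?P I))"
    unfolding sum_distrib_left by (intro sum.cong refl) (auto simp: mult_ac)
  also have "\<dots> \<le> (\<Sum>v\<in>(\<lambda>I. u I n) ` J. (1/2) ^ Suc v * 1)"
  proof (intro sum_mono mult_left_mono Suc.IH)
    fix v I I' assume "I \<in> {I \<in> J. u I n = v}" "I' \<in> {I \<in> J. u I n = v}" "I \<noteq> I'"
    with Suc.prems(2)[of I I'] show "\<exists>m<n. u I m \<noteq> u I' m" by (auto simp: less_Suc_eq)
  qed (use Suc.prems in auto)
  also have "\<dots> = (\<Sum>v\<in>(\<lambda>I. u I n) ` J. (1/2) ^ v) / 2"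
    by (simp add: sum_divide_distrib)
  also have "\<dots> \<le> 1" using sum_half_powers_le[of "(\<lambda>I. u I n) ` J"] Suc.prems(1) by simp
  finally show ?case .
qed

definition diagonal :: "nat \<Rightarrow> nat" where
  "diagonal k = fst (prod_decode k) + snd (prod_decode k)"

lemma prod_encode_triangle: "prod_encode (a, b) = triangle (a + b) + a"
  by (simp add: prod_encode_def)

lemma triangle_mono: "m \<le> n \<Longrightarrow> triangle m \<le> triangle n"
  by (induction n rule: dec_induct) auto

lemma le_triangle: "n \<le> triangle n"
  by (induction n) auto

lemma diagonal_bounds: "triangle (diagonal k) \<le> k" "k < triangle (Suc (diagonal k))"
proof -
  have "k = triangle (diagonal k) + fst (prod_decode k)"
    using prod_encode_triangle[of "fst (prod_decode k)" "snd (prod_decode k)"] by (simp add: diagonal_def)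
  moreover have "fst (prod_decode k) \<le> diagonal k" by (simp add: diagonal_def)
  ultimately show "triangle (diagonal k) \<le> k" "k < triangle (Suc (diagonal k))" by simp_all
qed

lemma diagonal_mono: "m \<le> k \<Longrightarrow> diagonal m \<le> diagonal k"
  using diagonal_bounds(1)[of m] diagonal_bounds(2)[of k] triangle_mono[of "Suc (diagonal k)" "diagonal m"]
  by (meson leD le_less_trans le_trans not_less_eq_eq)

section \<open>The approximation of the path\<close>

definition strings :: "nat \<Rightarrow> bool list list" where
  "strings n = rec_nat [[]] (\<lambda>_ S. map (Cons False) S @ map (Cons True) S) n"

lemma set_strings: "set (strings n) = {\<tau>. length \<tau> = n}"
proof (induction n)
  case (Suc n)
  have "{\<tau>. length \<tau> = Suc n} = Cons False ` {\<tau>. length \<tau> = n} \<union> Cons True ` {\<tau>. length \<tau> = n}"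
    by (auto simp: length_Suc_conv)
  with Suc show ?case by (simp add: strings_def)
qed (simp add: strings_def)

lemma cfun_strings [cfun_intros]: "cfun f \<Longrightarrow> cfun (\<lambda>x. strings (f x))"
  unfolding strings_def by (intro cfun_intros)

text \<open>The number \<open>e\<close> codes a pair of programs: the first enumerates a set with
  the empty oracle, whence the string of \<open>False\<close>, and the second is the functional that
  appears in \<open>candidate\<close>.\<close>

definition enumerated :: "nat \<Rightarrow> nat \<Rightarrow> nat \<Rightarrow> bool" where
  "enumerated e t x \<longleftrightarrow> eval_string (replicate t False) (fst (prod_decode e)) x \<noteq> 0"

lemma cfun_enumerated [cfun_intros]:
  assumes "cfun e" "cfun t" "cfun x"
  shows "cfun (\<lambda>z. enumerated (e z) (t z) (x z))"
proof -
  have "cfun (\<lambda>z. eval_string (map (\<lambda>_. False) [0..<t z]) (fst (prod_decode (e z))) (x z) \<noteq> 0)"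
    by (intro cfun_intros assms)
  then show ?thesis by (simp add: enumerated_def map_replicate_const)
qed

lemma enumerated_mono: "enumerated e t x \<Longrightarrow> t \<le> t' \<Longrightarrow> enumerated e t' x"
  unfolding enumerated_def
  by (subst eval_string_mono) (auto simp: prefix_def le_iff_add replicate_add)

lemma enumerated_bound: "enumerated e t x \<Longrightarrow> x < t"
  unfolding enumerated_def by (drule eval_string_bound) simp

lemma eventually_enumerated: "\<exists>b. \<forall>\<^sub>F t in sequentially. enumerated e t x = b"
  by (cases "\<exists>t. enumerated e t x") (auto simp: eventually_sequentially intro: enumerated_mono)

lemma eventually_enumerated_ce:
  "\<forall>\<^sub>F t in sequentially. enumerated (prod_encode (rcode q, e)) t x \<longleftrightarrow> (\<exists>y. reval {} q [x] y)"
proof (cases "\<exists>y. reval {} q [x] y")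
  case True
  then obtain y where "reval {} q [x] y" by blast
  from eventually_eval_string[OF this] True show ?thesis
    by (auto elim!: eventually_mono simp: enumerated_def restrict_empty)
next
  case False
  have "\<not> enumerated (prod_encode (rcode q, e)) t x" for t
    using eval_string_sound[of "{}" t q x] False
    by (cases "eval_string (replicate t False) (rcode q) x") (auto simp: enumerated_def restrict_empty)
  with False show ?thesis by simp
qed

section \<open>Conditions and the strings that avoid them\<close>

type_synonym condition = "nat \<times> nat \<times> (nat \<times> nat) list"

text \<open>
  A condition \<open>(l, p, ps)\<close> stands for the class of all \<open>X\<close> such that the program \<open>p\<close> with oracle \<open>X\<close>
  fails to compute some of the input-output pairs in \<open>ps\<close>; a string is known to lie outside of this class
  once it is hit. The label \<open>l\<close> is \<open>Suc e\<close> if the condition is imposed for the \<open>e\<close>-th requirement,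
  and \<open>0\<close> if it fixes a bit of the path.
\<close>

definition hit :: "condition \<Rightarrow> bool list \<Rightarrow> bool" where
  "hit co \<tau> \<longleftrightarrow> list_all (\<lambda>z. eval_string \<tau> (fst (snd co)) (fst z) = Suc (snd z)) (snd (snd co))"

lemma cfun_hit [cfun_intros]:
  assumes "cfun co" "cfun \<tau>"
  shows "cfun (\<lambda>x. hit (co x) (\<tau> x))"
proof -
  have "cfun (\<lambda>z. hit (fst z) (snd z))"
    unfolding hit_def by (intro cfun_intros)
  from cfun_comp[OF this cfun_Pair[OF assms]] show ?thesis by simp
qed

lemma hit_mono: "hit co \<tau> \<Longrightarrow> prefix \<tau> \<tau>' \<Longrightarrow> hit co \<tau>'"
  unfolding hit_def list_all_iff using eval_string_mono by (metis nat.distinct(1))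

text \<open>\<open>prod_encode (3, 0)\<close> is \<open>rcode Oracle\<close>, so this condition
  stands for the class of all oracles without the element \<open>j\<close>.\<close>

lemma eventually_hit_oracle:
  "\<forall>\<^sub>F n in sequentially. \<forall>\<tau>. length \<tau> = n \<longrightarrow> j < n \<and> (hit (0, prod_encode (3, 0), [(j, 1)]) \<tau> \<longleftrightarrow> \<tau> ! j)"
proof -
  have "j < length \<tau> \<and> (hit (0, prod_encode (3, 0), [(j, 1)]) \<tau> \<longleftrightarrow> \<tau> ! j)"
    if large: "Suc (Suc (j + prod_encode (prod_encode (3, 0), list_encode [j]))) \<le> length \<tau>" for \<tau>
  proof -
    from large obtain n where n: "length \<tau> = Suc n" by (cases "length \<tau>") auto
    with large have "eval_upto \<tau> (Suc n) (rcode Oracle) [j] = ev_step \<tau> n (eval_upto \<tau> n) (rcode Oracle) [j]"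
      unfolding eval_upto_Suc rcode.simps by simp
    with n large have "eval_string \<tau> (prod_encode (3, 0)) j = Suc (of_bool (\<tau> ! j))"
      by (simp only: ev_step_rcode list.case) (simp add: eval_string_def)
    with large show ?thesis by (simp add: hit_def)
  qed
  then show ?thesis unfolding eventually_sequentially by blast
qed

definition avoids :: "condition option list \<Rightarrow> bool list \<Rightarrow> bool" where
  "avoids d \<tau> \<longleftrightarrow> list_all (\<lambda>o'. case o' of None \<Rightarrow> True | Some co \<Rightarrow> \<not> hit co \<tau>) d"

lemma cfun_avoids [cfun_intros]:
  assumes "cfun d" "cfun \<tau>"
  shows "cfun (\<lambda>x. avoids (d x) (\<tau> x))"
proof -
  have "cfun (\<lambda>z. avoids (fst z) (snd z))"
    unfolding avoids_def by (intro cfun_intros)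
  from cfun_comp[OF this cfun_Pair[OF assms]] show ?thesis by simp
qed

lemma avoids_iff: "avoids d \<tau> \<longleftrightarrow> (\<forall>co. Some co \<in> set d \<longrightarrow> \<not> hit co \<tau>)"
  unfolding avoids_def list_all_iff by (auto split: option.splits)

lemma avoids_simps [simp]:
  "avoids [] \<tau>" "avoids (d @ [None]) \<tau> \<longleftrightarrow> avoids d \<tau>"
  "avoids (d @ [Some co]) \<tau> \<longleftrightarrow> avoids d \<tau> \<and> \<not> hit co \<tau>"
  by (auto simp: avoids_def)

lemma avoids_antimono: "avoids d \<tau>' \<Longrightarrow> prefix \<tau> \<tau>' \<Longrightarrow> avoids d \<tau>"
  unfolding avoids_iff using hit_mono by blast

lemma avoids_take: "avoids d \<tau> \<Longrightarrow> avoids (take k d) \<tau>"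
  unfolding avoids_iff by (meson in_set_takeD)

locale cost_construction =
  fixes T :: "bool list set" and c :: "nat \<Rightarrow> nat \<Rightarrow> rat" and num den :: "nat \<Rightarrow> nat \<Rightarrow> nat"
  assumes tree: "computable_tree T" and path: "paths T \<noteq> {}"
    and num: "computable2 num" and den: "computable2 den"
    and den_pos: "\<And>x s. den x s > 0" and c_eq: "\<And>x s. c x s = of_nat (num x s) / of_nat (den x s)"
    and monotonic: "monotonic_cost c" and limit: "limit_condition c"
begin

definition cost :: "nat \<Rightarrow> nat \<Rightarrow> real" where
  "cost x s = real_of_rat (c x s)"

lemma cost_eq: "cost x s = real (num x s) / real (den x s)"
  by (simp add: cost_def c_eq of_rat_divide)

lemma cost_nonneg: "cost x s \<ge> 0"
  by (simp add: cost_eq)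

lemma cost_antimono: "x \<le> y \<Longrightarrow> cost y s \<le> cost x s"
proof (induction y rule: dec_induct)
  case (step y)
  then show ?case using monotonic by (auto simp: cost_def monotonic_cost_def of_rat_less_eq intro: order_trans)
qed simp

lemma cost_mono: "s \<le> t \<Longrightarrow> cost x s \<le> cost x t"
proof (induction t rule: dec_induct)
  case (step t)
  then show ?case using monotonic by (auto simp: cost_def monotonic_cost_def of_rat_less_eq intro: order_trans)
qed simp

lemma cost_zero: "s < x \<Longrightarrow> cost x s = 0"
  using monotonic by (simp add: cost_def monotonic_cost_def)

text \<open>As the cost does not decrease with the stage, its limit inferior is a supremum; a bound
  on it holds at all stages at once.\<close>

lemma cost_limit:
  assumes "\<epsilon> > 0"
  shows "\<exists>x. \<forall>s. cost x s \<le> \<epsilon>"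
proof -
  have "\<forall>\<^sub>F x in sequentially. liminf (\<lambda>s. ereal (cost x s)) < ereal \<epsilon>"
    using limit assms unfolding limit_condition_def cost_def by (intro order_tendstoD) auto
  then obtain x where x: "liminf (\<lambda>s. ereal (cost x s)) < ereal \<epsilon>"
    unfolding eventually_sequentially by blast
  have "cost x s \<le> \<epsilon>" for s
  proof (rule ccontr)
    assume "\<not> cost x s \<le> \<epsilon>"
    then have "\<epsilon> \<le> cost x t" if "s \<le> t" for t
      using cost_mono[OF that, of x] by simp
    then have "ereal \<epsilon> \<le> liminf (\<lambda>s. ereal (cost x s))"
      by (intro Liminf_bounded) (auto simp: eventually_sequentially)
    with x show False by simp
  qed
  then show ?thesis by blast
qed

subsection \<open>Lengths of agreement\<close>

text \<open>
  The first summand makes the total cost of the modules with a given index small. The second one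
  leaves room for the \<open>n\<close> states of the modules with smaller index: each of them is at most \<open>4 * l + 1\<close>.
\<close>

definition weight :: "nat \<Rightarrow> nat \<Rightarrow> nat" where
  "weight n l = n + n * (4 * l + 2)"

definition len :: "nat \<Rightarrow> nat \<Rightarrow> nat" where
  "len n t = rec_nat 0 (\<lambda>n l. l + (LEAST r. num r t * 2 ^ weight n l \<le> den r t)) n"

text \<open>Clearing denominators leaves a comparison of natural numbers, which makes
  \<open>len\<close> computable.\<close>

lemma cost_le_iff: "cost r t \<le> (1/2) ^ w \<longleftrightarrow> num r t * 2 ^ w \<le> den r t"
proof -
  have "cost r t \<le> (1/2) ^ w \<longleftrightarrow> real (num r t) * 2 ^ w \<le> real (den r t)"
    using den_pos[of r t] by (simp add: cost_eq power_divide field_simps)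
  also have "real (num r t) * 2 ^ w = real (num r t * 2 ^ w)" by simp
  finally show ?thesis by (simp only: of_nat_le_iff)
qed

lemma ex_cheap: "\<exists>r. num r t * 2 ^ w \<le> den r t"
  using cost_zero[of t "Suc t"] by (intro exI[of _ "Suc t"]) (simp flip: cost_le_iff)

lemma len_0 [simp]: "len 0 t = 0"
  by (simp add: len_def)

lemma len_Suc: "len (Suc n) t = len n t + (LEAST r. cost r t \<le> (1/2) ^ weight n (len n t))"
  by (simp add: len_def cost_le_iff)

lemma ex_cheap': "\<exists>r. cost r t \<le> (1/2) ^ w"
  using ex_cheap by (simp add: cost_le_iff)

lemma len_le: "n \<le> n' \<Longrightarrow> len n t \<le> len n' t"
  by (induction n' rule: dec_induct) (auto simp: len_Suc)

lemma cost_len: "cost (len (Suc n) t) t \<le> (1/2) ^ weight n (len n t)"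
proof -
  have "cost (LEAST r. cost r t \<le> (1/2) ^ weight n (len n t)) t \<le> (1/2) ^ weight n (len n t)"
    using ex_cheap' by (rule LeastI_ex)
  then show ?thesis using cost_antimono[OF le_add2] unfolding len_Suc by (rule order_trans[rotated])
qed

lemma weight_mono: "l \<le> l' \<Longrightarrow> weight n l \<le> weight n l'"
  by (simp add: weight_def)

text \<open>A later stage has higher costs and, through the preceding length, a higher weight. So a
  number that is cheap enough there is cheap enough at the earlier stage.\<close>

lemma len_mono: "t \<le> t' \<Longrightarrow> len n t \<le> len n t'"
proof (induction n)
  case (Suc n)
  define r where "r = (LEAST r. cost r t' \<le> (1/2) ^ weight n (len n t'))"
  have "cost r t \<le> cost r t'" by (rule cost_mono[OF Suc.prems])
  also have "\<dots> \<le> (1/2) ^ weight n (len n t')"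
    using ex_cheap' unfolding r_def by (rule LeastI_ex)
  also have "\<dots> \<le> (1/2) ^ weight n (len n t)"
    using Suc by (intro power_decreasing weight_mono) auto
  finally have "(LEAST r. cost r t \<le> (1/2) ^ weight n (len n t)) \<le> r" by (rule Least_le)
  with Suc show ?case by (simp add: len_Suc r_def[symmetric])
qed simp

text \<open>Here the limit condition enters: once the preceding length has settled, some number is
  cheap enough at all stages, and it bounds the next increment.\<close>

lemma eventually_len: "\<exists>l. \<forall>\<^sub>F t in sequentially. len n t = l"
proof (induction n)
  case (Suc n)
  then obtain l where l: "\<forall>\<^sub>F t in sequentially. len n t = l" by blast
  then obtain t0 where t0: "\<And>t. t0 \<le> t \<Longrightarrow> len n t = l" unfolding eventually_sequentially by blast
  obtain x where x: "\<And>s. cost x s \<le> (1/2) ^ weight n l" using cost_limit[of "(1/2) ^ weight n l"] by auto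
  have bound: "len (Suc n) t \<le> l + x" if "t0 \<le> t" for t
    using t0[OF that] x[of t] by (simp add: len_Suc Least_le)
  have "len (Suc n) t \<le> l + x" for t
    using bound[of "max t t0"] len_mono[of t "max t t0" "Suc n"] by simp
  then show ?case
    by (intro mono_bounded_nat_eventually_const[of _ "l + x"]) (auto intro: monoI len_mono)
qed simp

subsection \<open>Pictures of the construction\<close>

text \<open>
  Module \<open>prod_encode (j, i)\<close> belongs to requirement \<open>j\<close> if \<open>i > 0\<close>, and fixes bit \<open>j\<close> if \<open>i = 0\<close>. Inside
  a diagonal the modules act in ascending order of \<open>j\<close>, whereas the lengths increase with \<open>i\<close>: the
  coordinates are swapped. Thus the length of a module is cheap in comparison with the number of
  times that the modules acting after it on the same diagonal can change.
\<close>

definition len_index :: "nat \<Rightarrow> nat" where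
  "len_index k = prod_encode (snd (prod_decode k), fst (prod_decode k))"

text \<open>The length with index \<open>n\<close> is \<open>len (Suc n)\<close>, because
  \<open>cost_len\<close> bounds its cost in terms of \<open>weight n\<close> and the preceding
  length \<open>len n\<close>.\<close>

definition candidate :: "nat \<Rightarrow> nat \<Rightarrow> condition" where
  "candidate t k = (let j = fst (prod_decode k) in
    if snd (prod_decode k) = 0 then (0, prod_encode (3, 0), [(j, 1)])
    else (Suc j, snd (prod_decode j),
      map (\<lambda>x. (x, of_bool (enumerated j t x))) [0..<len (Suc (len_index k)) t]))"

text \<open>By compactness the class is nonempty iff every level has such a string. Testing level
  \<open>t\<close> alone gives an approximation that can only turn from true to false.\<close>

definition alive :: "nat \<Rightarrow> condition option list \<Rightarrow> bool" where
  "alive t d \<longleftrightarrow> list_ex (\<lambda>\<tau>. \<tau> \<in> T \<and> avoids d \<tau>) (strings t)"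

definition has_label :: "nat \<Rightarrow> condition option list \<Rightarrow> bool" where
  "has_label l d \<longleftrightarrow> list_ex (\<lambda>o'. case o' of None \<Rightarrow> False | Some co \<Rightarrow> fst co = l) d"

text \<open>A requirement that has acted is met, and its later modules are switched off. So a label
  occurs at most once in a picture unless it is 0.\<close>

definition entry :: "nat \<Rightarrow> nat \<Rightarrow> condition option list \<Rightarrow> condition option" where
  "entry t k d = (let co = candidate t k in
    if fst co \<noteq> 0 \<and> has_label (fst co) d then None
    else if alive t (d @ [Some co]) then Some co else None)"

definition picture :: "nat \<Rightarrow> nat \<Rightarrow> condition option list" where
  "picture t k = rec_nat [] (\<lambda>k d. d @ [entry t k d]) k"

lemma cfun_mem_T [cfun_intros]:
  assumes "cfun f"
  shows "cfun (\<lambda>x. f x \<in> T)"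
proof (rule cfun_comp[OF _ assms])
  have "inj string_code"
    using inj_enc[where ?'a = "bool list"] by (simp add: enc_bool_list[abs_def] inj_def enc_bool_list)
  then have "string_code \<sigma> \<in> string_code ` T \<longleftrightarrow> \<sigma> \<in> T" for \<sigma>
    by (rule inj_image_mem_iff)
  then show "cfun (\<lambda>\<sigma>. \<sigma> \<in> T)"
    using tree unfolding computable_tree_def computable_set_def
    by (intro cfunI[of "\<lambda>x. of_bool (x \<in> string_code ` T)"]) (auto simp: enc_bool_list)
qed

lemma cfun_len [cfun_intros]:
  assumes "cfun n" "cfun t"
  shows "cfun (\<lambda>x. len (n x) (t x))"
proof -
  have nd: "cfun (\<lambda>x. num (f x) (g x))" "cfun (\<lambda>x. den (f x) (g x))"
    if "cfun f" "cfun g" for f g :: "'b::enc \<Rightarrow> nat"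
    using that by (auto intro: cfun_computable2[OF num] cfun_computable2[OF den])
  have "cfun (\<lambda>z. len (fst z) (snd z))"
    unfolding len_def weight_def by (intro cfun_intros nd) (auto intro: ex_cheap)
  from cfun_comp[OF this cfun_Pair[OF assms]] show ?thesis by simp
qed

lemma cfun_candidate: "cfun (\<lambda>z. candidate (fst z) (snd z))"
  unfolding candidate_def Let_def len_index_def by (intro cfun_intros)

lemma cfun_alive: "cfun (\<lambda>z. alive (fst z) (snd z))"
  unfolding alive_def by (intro cfun_intros)

lemma cfun_has_label [cfun_intros]:
  assumes "cfun l" "cfun d"
  shows "cfun (\<lambda>x. has_label (l x) (d x))"
proof -
  have "cfun (\<lambda>z. has_label (fst z) (snd z))"
    unfolding has_label_def by (intro cfun_intros)
  from cfun_comp[OF this cfun_Pair[OF assms]] show ?thesis by simp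
qed

lemma cfun_picture [cfun_intros]:
  assumes "cfun t" "cfun k"
  shows "cfun (\<lambda>x. picture (t x) (k x))"
proof -
  have candidate: "cfun (\<lambda>x. candidate (f x) (g x))" if "cfun f" "cfun g" for f g :: "'b::enc \<Rightarrow> nat"
    using cfun_comp[OF cfun_candidate cfun_Pair[OF that]] by simp
  have alive: "cfun (\<lambda>x. alive (f x) (g x))" if "cfun f" "cfun g"
    for f :: "'b::enc \<Rightarrow> nat" and g :: "'b \<Rightarrow> condition option list"
    using cfun_comp[OF cfun_alive cfun_Pair[OF that]] by simp
  have "cfun (\<lambda>z. picture (fst z) (snd z))"
    unfolding picture_def entry_def Let_def by (intro cfun_intros candidate alive)
  from cfun_comp[OF this cfun_Pair[OF assms]] show ?thesis by simp
qed

lemma alive_iff: "alive t d \<longleftrightarrow> (\<exists>\<tau>. length \<tau> = t \<and> \<tau> \<in> T \<and> avoids d \<tau>)"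
  by (auto simp: alive_def list_ex_iff set_strings)

lemma T_prefix: "\<sigma> \<in> T \<Longrightarrow> prefix \<tau> \<sigma> \<Longrightarrow> \<tau> \<in> T"
  using tree unfolding computable_tree_def by blast

lemma alive_antimono: "alive t' d \<Longrightarrow> t \<le> t' \<Longrightarrow> alive t d"
  unfolding alive_iff
  by (metis avoids_antimono T_prefix length_take min.absorb2 take_is_prefix)

lemma picture_0 [simp]: "picture t 0 = []"
  by (simp add: picture_def)

lemma picture_Suc: "picture t (Suc k) = picture t k @ [entry t k (picture t k)]"
  by (simp add: picture_def)

lemma length_picture [simp]: "length (picture t k) = k"
  by (induction k) (auto simp: picture_Suc)

lemma take_picture: "k \<le> k' \<Longrightarrow> take k (picture t k') = picture t k"
  by (induction k' rule: dec_induct) (auto simp: picture_Suc)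

lemma nth_picture: "k < k' \<Longrightarrow> picture t k' ! k = entry t k (picture t k)"
  using take_picture[of "Suc k" k' t] by (metis lessI length_picture nth_append_length nth_take picture_Suc Suc_leI)

lemma entry_SomeD:
  "entry t k d = Some co \<Longrightarrow>
    co = candidate t k \<and> alive t (d @ [Some co]) \<and> (fst co \<noteq> 0 \<longrightarrow> \<not> has_label (fst co) d)"
  by (auto simp: entry_def Let_def split: if_splits)

lemma alive_picture: "alive t (picture t k)"
proof (induction k)
  case 0
  obtain X where "X \<in> paths T" using path by blast
  then show ?case unfolding alive_iff paths_def by (intro exI[of _ "restrict X t"]) simp
next
  case (Suc k)
  show ?case
  proof (cases "entry t k (picture t k)")
    case None
    with Suc show ?thesis by (simp add: picture_Suc alive_iff)
  next
    case (Some co)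
    with entry_SomeD[OF Some] show ?thesis by (auto simp: picture_Suc)
  qed
qed

subsection \<open>Convergence\<close>

lemma eventually_candidate: "\<exists>co. \<forall>\<^sub>F t in sequentially. candidate t k = co"
proof (cases "snd (prod_decode k) = 0")
  case False
  define j where "j = fst (prod_decode k)"
  obtain l where l: "\<forall>\<^sub>F t in sequentially. len (Suc (len_index k)) t = l"
    using eventually_len by blast
  obtain b where "\<And>x. \<forall>\<^sub>F t in sequentially. enumerated j t x = b x"
    using eventually_enumerated by metis
  then have "\<forall>\<^sub>F t in sequentially. \<forall>x\<in>{..<l}. enumerated j t x = b x"
    by (intro eventually_ball_finite) auto
  with l have "\<forall>\<^sub>F t in sequentially. candidate t k = (Suc j, snd (prod_decode j), map (\<lambda>x. (x, of_bool (b x))) [0..<l])"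
    by eventually_elim (use False in \<open>simp add: candidate_def Let_def j_def\<close>)
  then show ?thesis by blast
qed (simp add: candidate_def)

lemma eventually_entry: "\<exists>en. \<forall>\<^sub>F t in sequentially. entry t k d = en"
proof -
  obtain co where co: "\<forall>\<^sub>F t in sequentially. candidate t k = co"
    using eventually_candidate by blast
  have "\<exists>b. \<forall>\<^sub>F t in sequentially. alive t (d @ [Some co]) = b"
  proof (cases "\<forall>t. alive t (d @ [Some co])")
    case False
    then obtain s where "\<not> alive s (d @ [Some co])" by blast
    then have "\<forall>t\<ge>s. alive t (d @ [Some co]) = False" using alive_antimono by blast
    then show ?thesis unfolding eventually_sequentially by blast
  qed auto
  then obtain b where "\<forall>\<^sub>F t in sequentially. alive t (d @ [Some co]) = b" by blast
  with co have "\<forall>\<^sub>F t in sequentially. entry t k d =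
      (if fst co \<noteq> 0 \<and> has_label (fst co) d then None else if b then Some co else None)"
    by eventually_elim (auto simp: entry_def Let_def)
  then show ?thesis by blast
qed

lemma eventually_picture: "\<exists>d. \<forall>\<^sub>F t in sequentially. picture t k = d"
proof (induction k)
  case (Suc k)
  then obtain d where d: "\<forall>\<^sub>F t in sequentially. picture t k = d" by blast
  obtain en where "\<forall>\<^sub>F t in sequentially. entry t k d = en" using eventually_entry by blast
  with d have "\<forall>\<^sub>F t in sequentially. picture t (Suc k) = d @ [en]"
    by eventually_elim (simp add: picture_Suc)
  then show ?case by blast
qed simp

definition final :: "nat \<Rightarrow> condition option list" where
  "final k = (SOME d. \<forall>\<^sub>F t in sequentially. picture t k = d)"

lemma eventually_final: "\<forall>\<^sub>F t in sequentially. picture t k = final k"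
  unfolding final_def by (rule someI_ex[OF eventually_picture])

lemma ex_final:
  obtains t where "s \<le> t" "picture t k = final k"
  using eventually_happens[OF eventually_conj[OF eventually_final[of k] eventually_ge_at_top[of s]]] by auto

lemma length_final [simp]: "length (final k) = k"
  by (metis ex_final length_picture)

lemma take_final: "k \<le> k' \<Longrightarrow> take k (final k') = final k"
proof -
  assume "k \<le> k'"
  obtain t where "picture t k = final k" "picture t k' = final k'"
    using eventually_happens[OF eventually_conj[OF eventually_final[of k] eventually_final[of k']]] by auto
  with take_picture[OF \<open>k \<le> k'\<close>] show ?thesis by metis
qed

lemma final_Suc: "final (Suc k) = final k @ [final (Suc k) ! k]"
  by (metis take_final le_refl length_final lessI less_imp_le take_Suc_conv_app_nth)

lemma eventually_final_entry: "\<forall>\<^sub>F t in sequentially. entry t k (final k) = final (Suc k) ! k"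
  using eventually_final[of k] eventually_final[of "Suc k"]
  by eventually_elim (metis lessI nth_picture)

subsection \<open>The limit path\<close>

text \<open>A bit module excludes the value 1 whenever the class survives this, so an idle module
  means that the bit is 1.\<close>

definition limit_path :: "nat set" where
  "limit_path = {j. nth_default None (final (Suc (prod_encode (j, 0)))) (prod_encode (j, 0)) = None}"

lemma limit_path_iff: "j \<in> limit_path \<longleftrightarrow> final (Suc (prod_encode (j, 0))) ! prod_encode (j, 0) = None"
  by (simp add: limit_path_def nth_default_def)

lemma delta02_limit_path: "delta02 limit_path"
proof (rule delta02_limit)
  show "cfun (\<lambda>z. nth_default None (picture (fst z) (Suc (prod_encode (snd z, 0)))) (prod_encode (snd z, 0)) = None)"
    by (intro cfun_intros)
  show "\<forall>\<^sub>F t in sequentially.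
      (nth_default None (picture t (Suc (prod_encode (j, 0)))) (prod_encode (j, 0)) = None) = (j \<in> limit_path)" for j
    using eventually_final[of "Suc (prod_encode (j, 0))"] by eventually_elim (simp add: limit_path_def)
qed

lemma eventually_bit:
  "\<forall>\<^sub>F t in sequentially. \<forall>\<tau>. length \<tau> = t \<longrightarrow> \<tau> \<in> T \<longrightarrow> avoids (final (Suc (prod_encode (j, 0)))) \<tau> \<longrightarrow>
    (\<tau> ! j \<longleftrightarrow> j \<in> limit_path)"
  using eventually_final_entry[of "prod_encode (j, 0)"] eventually_hit_oracle[of j]
proof eventually_elim
  case (elim t)
  let ?m = "prod_encode (j, 0)"
  have co: "candidate t ?m = (0, prod_encode (3, 0), [(j, 1)])"
    by (simp add: candidate_def)
  show ?case
  proof (intro allI impI)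
    fix \<tau> assume \<tau>: "length \<tau> = t" "\<tau> \<in> T" and "avoids (final (Suc ?m)) \<tau>"
    then have av: "avoids (final ?m @ [final (Suc ?m) ! ?m]) \<tau>"
      using final_Suc[of ?m] by simp
    show "\<tau> ! j \<longleftrightarrow> j \<in> limit_path"
    proof (cases "final (Suc ?m) ! ?m")
      case None
      with elim(1) co have "\<not> alive t (final ?m @ [Some (0, prod_encode (3, 0), [(j, 1)])])"
        by (auto simp: entry_def split: if_splits)
      with av \<tau> None have "hit (0, prod_encode (3, 0), [(j, 1)]) \<tau>" by (auto simp: alive_iff)
      with elim(2) \<tau> None show ?thesis by (simp add: limit_path_iff)
    next
      case (Some co')
      with elim(1) co entry_SomeD[of t ?m "final ?m" co'] have "co' = (0, prod_encode (3, 0), [(j, 1)])"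
        by simp
      with av elim(2) \<tau> Some show ?thesis by (simp add: limit_path_iff)
    qed
  qed
qed

lemma limit_path_avoids:
  "\<exists>\<tau>\<in>T. avoids (final k) \<tau> \<and> prefix (restrict limit_path n) \<tau>"
proof -
  \<comment> \<open>\<open>K\<close> also takes in the modules that fix the bits below
    \<open>n\<close>. Hence a string that keeps \<open>final K\<close> alive at a late stage must
    agree with the path on these bits.\<close>
  define K where "K = k + (\<Sum>j<n. Suc (prod_encode (j, 0)))"
  have K: "Suc (prod_encode (j, 0)) \<le> K" if "j < n" for j
    using member_le_sum[of j "{..<n}" "\<lambda>j. Suc (prod_encode (j, 0))"] that unfolding K_def by simp
  have "\<forall>\<^sub>F t in sequentially. \<forall>j\<in>{..<n}. \<forall>\<tau>. length \<tau> = t \<longrightarrow> \<tau> \<in> T \<longrightarrow>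
      avoids (final (Suc (prod_encode (j, 0)))) \<tau> \<longrightarrow> (\<tau> ! j \<longleftrightarrow> j \<in> limit_path)"
    by (intro eventually_ball_finite ballI eventually_bit) auto
  from eventually_happens[OF eventually_conj[OF this eventually_conj[OF eventually_final[of K] eventually_ge_at_top[of n]]]]
  obtain t where t: "\<And>j \<tau>. j < n \<Longrightarrow> length \<tau> = t \<Longrightarrow> \<tau> \<in> T \<Longrightarrow>
      avoids (final (Suc (prod_encode (j, 0)))) \<tau> \<Longrightarrow> \<tau> ! j \<longleftrightarrow> j \<in> limit_path"
    and fin: "picture t K = final K" and "n \<le> t" by auto
  from alive_picture[of t K] obtain \<tau> where \<tau>: "length \<tau> = t" "\<tau> \<in> T" "avoids (final K) \<tau>"
    unfolding alive_iff fin by blast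
  have av: "avoids (final k') \<tau>" if "k' \<le> K" for k'
    using avoids_take[OF \<tau>(3), of k'] take_final[OF that] by simp
  have "take n \<tau> = restrict limit_path n"
    using \<open>n \<le> t\<close> \<tau> t av K by (intro nth_equalityI) auto
  then have "prefix (restrict limit_path n) \<tau>"
    by (metis take_is_prefix)
  then show ?thesis using \<tau> av[of k] by (auto simp: K_def)
qed

lemma limit_path_in_paths: "limit_path \<in> paths T"
  unfolding paths_def using limit_path_avoids T_prefix by blast

lemma limit_path_not_hit: "Some co \<in> set (final k) \<Longrightarrow> \<not> hit co (restrict limit_path n)"
  using limit_path_avoids[of k n] hit_mono unfolding avoids_iff by blast

lemma has_label_iff: "has_label l d \<longleftrightarrow> (\<exists>co. Some co \<in> set d \<and> fst co = l)"
  by (fastforce simp: has_label_def list_ex_iff split: option.splits)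

text \<open>An action in the limit would force the path to err somewhere on the true values of
  \<open>W\<close> below the settled length, but \<open>p\<close> computes all of them from the
  path.\<close>

lemma no_label_final:
  assumes e: "e = prod_encode (rcode q, rcode p)"
    and W: "W = {x. \<exists>y. reval {} q [x] y}"
    and p: "\<And>x. reval limit_path p [x] (of_bool (x \<in> W))"
  shows "\<not> has_label (Suc e) (final k)"
proof
  assume "has_label (Suc e) (final k)"
  then obtain co where co: "Some co \<in> set (final k)" "fst co = Suc e" unfolding has_label_iff by blast
  then obtain k' where k': "k' < k" "final k ! k' = Some co" by (auto simp: in_set_conv_nth)
  then have fin: "final (Suc k') ! k' = Some co"
    using take_final[of "Suc k'" k] by (metis Suc_leI lessI nth_take)
  obtain r where r: "\<forall>\<^sub>F t in sequentially. len (Suc (len_index k')) t = r"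
    using eventually_len by blast
  have "\<forall>\<^sub>F t in sequentially. \<forall>x\<in>{..<r}. enumerated e t x \<longleftrightarrow> x \<in> W"
    unfolding W e using eventually_enumerated_ce by (intro eventually_ball_finite) auto
  then have "\<forall>\<^sub>F t in sequentially. co = (Suc e, rcode p, map (\<lambda>x. (x, of_bool (x \<in> W))) [0..<r])"
    using r eventually_final_entry[of k']
  proof eventually_elim
    case (elim t)
    from elim(3) fin have "co = candidate t k'"
      by (auto dest: entry_SomeD)
    with co(2) elim(1,2) show ?case
      by (auto simp: candidate_def Let_def e split: if_splits)
  qed
  then have co_eq: "co = (Suc e, rcode p, map (\<lambda>x. (x, of_bool (x \<in> W))) [0..<r])" by simp
  have "\<forall>\<^sub>F n in sequentially. \<forall>x\<in>{..<r}. eval_string (restrict limit_path n) (rcode p) x = Suc (of_bool (x \<in> W))"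
    using eventually_eval_string[OF p] by (intro eventually_ball_finite) auto
  then have "\<forall>\<^sub>F n in sequentially. hit co (restrict limit_path n)"
    by eventually_elim (simp add: co_eq hit_def list_all_iff)
  with limit_path_not_hit[OF co(1)] show False by simp
qed

lemma len_index_prod_encode [simp]: "len_index (prod_encode (j, i)) = prod_encode (i, j)"
  by (simp add: len_index_def)

lemma len_index_len_index [simp]: "len_index (len_index k) = k"
  by (simp add: len_index_def)

subsection \<open>Agreement\<close>

text \<open>
  If the module for \<open>e\<close> is idle at stage \<open>t\<close>, then the whole class computes the current approximation of
  the enumerated set correctly. An enumeration below the length of agreement makes this class err,
  and the module can act as long as the class is nonempty.
\<close>

lemma agreement:
  assumes k: "k = prod_encode (e, i)" "i > 0" and t: "t \<le> t'" "picture t k = picture t' k"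
    and idle: "\<not> has_label (Suc e) (picture t (Suc k))" "\<not> has_label (Suc e) (picture t' (Suc k))"
    and x: "enumerated e t' x" "\<not> enumerated e t x"
  shows "len (Suc (len_index k)) t \<le> x"
proof (rule ccontr)
  assume "\<not> len (Suc (len_index k)) t \<le> x"
  then have less: "x < len (Suc (len_index k)) t" "x < len (Suc (len_index k)) t'"
    using len_mono[OF t(1), of "Suc (len_index k)"] by auto
  define d where "d = picture t k"
  have cand: "candidate s k = (Suc e, snd (prod_decode e),
      map (\<lambda>x. (x, of_bool (enumerated e s x))) [0..<len (Suc (len_index k)) s])" for s
    using k by (simp add: candidate_def)
  have dead: "\<not> alive s (d @ [Some (candidate s k)])"
    if "picture s k = d" "\<not> has_label (Suc e) (picture s (Suc k))" for s
  proof -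
    have "\<not> has_label (Suc e) d"
      using that by (auto simp: picture_Suc has_label_iff)
    moreover have "entry s k d \<noteq> Some (candidate s k)"
    proof
      assume "entry s k d = Some (candidate s k)"
      then have "has_label (Suc e) (picture s (Suc k))"
        unfolding has_label_iff using that(1)
        by (intro exI[of _ "candidate s k"]) (simp add: picture_Suc cand)
      with that(2) show False ..
    qed
    ultimately show ?thesis by (auto simp: entry_def Let_def cand)
  qed
  \<comment> \<open>One string of level \<open>t'\<close> serves both stages: it is hit at
    \<open>t'\<close> with output 1 at \<open>x\<close>, while its initial segment of length
    \<open>t\<close> is hit at \<open>t\<close> with output 0.\<close>
  obtain \<tau>' where \<tau>': "length \<tau>' = t'" "\<tau>' \<in> T" "avoids d \<tau>'"
    using alive_picture[of t' k] t(2) unfolding alive_iff d_def by auto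
  have pre: "prefix (take t \<tau>') \<tau>'" by (rule take_is_prefix)
  have "hit (candidate t' k) \<tau>'"
    using dead[of t'] idle(2) t(2) \<tau>' by (auto simp: d_def alive_iff)
  then have "eval_string \<tau>' (snd (prod_decode e)) x = Suc 1"
    using less x by (auto simp: hit_def cand list_all_iff)
  moreover have "hit (candidate t k) (take t \<tau>')"
    using dead[of t] idle(1) t(1) \<tau>' T_prefix[OF _ pre] avoids_antimono[OF _ pre]
    by (auto simp: d_def alive_iff)
  then have "eval_string (take t \<tau>') (snd (prod_decode e)) x = Suc 0"
    using less x by (auto simp: hit_def cand list_all_iff)
  ultimately show False using eval_string_mono[OF _ pre, of "snd (prod_decode e)" x] by simp
qed

text \<open>A potential for module \<open>k\<close> while the modules before it stand still. If the
  length or the enumerated part grows, the doubled sum gains at least 2, which pays for a possible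
  drop of the last bit. If neither grows, the candidate is the same, and the module can only go from
  acting to idle.\<close>

definition state :: "nat \<Rightarrow> nat \<Rightarrow> nat" where
  "state k t = 2 * (len (Suc (len_index k)) t +
      card {x. x < len (Suc (len_index k)) t \<and> enumerated (fst (prod_decode k)) t x}) +
    of_bool (entry t k (picture t k) = None)"

lemma state_bound: "state k t \<le> 4 * len (Suc (len_index k)) t + 1"
proof -
  have "card {x. x < len (Suc (len_index k)) t \<and> enumerated (fst (prod_decode k)) t x} \<le> len (Suc (len_index k)) t"
    using card_mono[of "{..<len (Suc (len_index k)) t}"] by (metis (no_types, lifting) card_lessThan finite_lessThan lessThan_iff mem_Collect_eq subsetI)
  then show ?thesis by (simp add: state_def)
qed

lemma state_mono:
  assumes "t \<le> t'" "picture t k = picture t' k"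
  shows "state k t \<le> state k t'"
    and "picture t (Suc k) \<noteq> picture t' (Suc k) \<Longrightarrow> state k t < state k t'"
proof -
  define l where "l s = len (Suc (len_index k)) s" for s
  define S where "S s = {x. x < l s \<and> enumerated (fst (prod_decode k)) s x}" for s
  define d where "d = picture t k"
  have d': "picture t' k = d" using assms(2) by (simp add: d_def)
  have l: "l t \<le> l t'" unfolding l_def by (rule len_mono[OF assms(1)])
  have S: "S t \<subseteq> S t'" using l enumerated_mono[OF _ assms(1)] by (auto simp: S_def)
  have fin: "finite (S t')" by (rule finite_subset[of _ "{..<l t'}"]) (auto simp: S_def)
  have st: "state k s = 2 * (l s + card (S s)) + of_bool (entry s k (picture s k) = None)" for s
    by (simp add: state_def l_def S_def)
  have "state k t \<le> state k t' \<and> (picture t (Suc k) \<noteq> picture t' (Suc k) \<longrightarrow> state k t < state k t')"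
  proof (cases "l t + card (S t) < l t' + card (S t')")
    case True
    then show ?thesis by (auto simp: st)
  next
    case False
    with l card_mono[OF fin S] have eq: "l t = l t'" "card (S t) = card (S t')" by auto
    with card_subset_eq[OF fin S] have "S t = S t'" by simp
    then have "\<And>x. x < l t \<Longrightarrow> enumerated (fst (prod_decode k)) t x \<longleftrightarrow> enumerated (fst (prod_decode k)) t' x"
      using eq by (auto simp: S_def)
    then have cand: "candidate t k = candidate t' k"
      using eq(1) by (auto simp: candidate_def Let_def l_def[symmetric])
    have "entry t k d = None \<Longrightarrow> entry t' k d = None"
      using alive_antimono[OF _ assms(1)] by (auto simp: entry_def cand Let_def split: if_splits)
    moreover have "entry t k d = entry t' k d" if "entry t k d \<noteq> None" "entry t' k d \<noteq> None"
      using that entry_SomeD cand by (metis option.exhaust)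
    ultimately show ?thesis
      using eq by (cases "entry t k d"; cases "entry t' k d") (simp_all add: st picture_Suc d' d_def[symmetric])
  qed
  then show "state k t \<le> state k t'"
    and "picture t (Suc k) \<noteq> picture t' (Suc k) \<Longrightarrow> state k t < state k t'" by auto
qed

end

section \<open>Sampling a c.e. set below the path at good stages\<close>

locale requirement = cost_construction +
  fixes e :: nat and q p :: recf and A :: "nat set"
  assumes e: "e = prod_encode (rcode q, rcode p)"
    and A: "A = {x. \<exists>y. reval {} q [x] y}"
    and red: "\<And>x. reval limit_path p [x] (of_bool (x \<in> A))"
begin

text \<open>If a label up to \<open>Suc e\<close> ever occurs in the limit, then it occurs in
  \<open>final M\<close>, as the sum is at least the chosen place. The triangular number puts all
  modules from \<open>M\<close> on into diagonals beyond \<open>e\<close>, so that a bit module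
  among them fixes a bit greater than \<open>e\<close>.\<close>

definition M :: nat where
  "M = triangle (Suc e) + (\<Sum>l\<le>Suc e. SOME k. has_label l (final k))"

text \<open>The last module inside the horizon belongs to requirement \<open>e\<close> itself, and
  its length index is at least \<open>I\<close>; this pays for the steps at which no outcome
  changes.\<close>

definition horizon :: "nat \<Rightarrow> nat" where
  "horizon I = Suc (prod_encode (e, M + Suc I))"

definition good :: "nat \<Rightarrow> nat \<Rightarrow> bool" where
  "good I t \<longleftrightarrow> picture t M = final M \<and>
    list_all (\<lambda>l. \<not> has_label (Suc l) (drop M (picture t (horizon I)))) [0..<Suc e]"

text \<open>Starting above 0 ensures \<open>Suc I \<le> stage I\<close>: the approximation pays by
  the cost at \<open>Suc I\<close>, whereas the lengths are computed from the cost at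
  \<open>stage I\<close>.\<close>

definition stage :: "nat \<Rightarrow> nat" where
  "stage I = rec_nat (LEAST t. 0 < t \<and> good 0 t) (\<lambda>I s. LEAST t. s < t \<and> good (Suc I) t) I"

definition approx :: "nat \<Rightarrow> nat set" where
  "approx I = {x. enumerated e (stage I) x}"

lemma M_le_horizon: "M \<le> horizon I"
  unfolding horizon_def using le_prod_encode_2[of "M + Suc I" e] by simp

lemma prod_encode_mono: "b \<le> b' \<Longrightarrow> prod_encode (a, b) \<le> prod_encode (a, b')"
  unfolding prod_encode_triangle by (simp add: triangle_mono)

lemma horizon_mono: "I \<le> I' \<Longrightarrow> horizon I \<le> horizon I'"
  unfolding horizon_def by (simp add: prod_encode_mono)

lemma has_label_final_mono: "has_label l (final k) \<Longrightarrow> k \<le> k' \<Longrightarrow> has_label l (final k')"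
  unfolding has_label_iff by (metis in_set_takeD take_final)

lemma has_label_M:
  assumes "l \<le> Suc e" "has_label l (final k)"
  shows "has_label l (final M)"
proof (rule has_label_final_mono)
  show "has_label l (final (SOME k. has_label l (final k)))"
    using assms(2) by (rule someI)
  show "(SOME k. has_label l (final k)) \<le> M"
    unfolding M_def
    by (rule trans_le_add2, rule member_le_sum[of l "{..Suc e}" "\<lambda>l. SOME k. has_label l (final k)"])
       (use assms(1) in auto)
qed

text \<open>If one of these labels occurred beyond \<open>M\<close> in the limit, then
  \<open>has_label_M\<close> would give an earlier occurrence in \<open>final M\<close>, and
  \<open>entry\<close> forbids the repetition.\<close>

lemma eventually_good: "\<forall>\<^sub>F t in sequentially. good I t"
  using eventually_final[of M] eventually_final[of "horizon I"]
proof eventually_elim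
  case (elim t)
  have "\<not> has_label (Suc l) (drop M (picture t (horizon I)))" if l: "l \<le> e" for l
  proof
    assume "has_label (Suc l) (drop M (picture t (horizon I)))"
    then obtain co where co: "Some co \<in> set (drop M (picture t (horizon I)))" "fst co = Suc l"
      unfolding has_label_iff by blast
    then obtain i where "i < horizon I - M" "drop M (picture t (horizon I)) ! i = Some co"
      by (auto simp: in_set_conv_nth)
    then have k: "M + i < horizon I" "picture t (horizon I) ! (M + i) = Some co"
      by (auto simp: M_le_horizon)
    then have "entry t (M + i) (picture t (M + i)) = Some co" by (simp add: nth_picture)
    then have "\<not> has_label (Suc l) (picture t (M + i))"
      using entry_SomeD co(2) by fastforce
    moreover have "picture t (M + i) = final (M + i)"
      using take_picture[of "M + i" "horizon I" t] take_final[of "M + i" "horizon I"] elim(2) k(1) by simp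
    moreover have "has_label (Suc l) (final M)"
    proof (rule has_label_M)
      show "has_label (Suc l) (final (horizon I))"
        using co elim(2) unfolding has_label_iff by (metis in_set_dropD)
    qed (use l in simp)
    ultimately show False using has_label_final_mono by simp
  qed
  with elim(1) show ?case by (auto simp: good_def list_all_iff less_Suc_eq_le)
qed

lemma ex_good: "\<exists>t. s < t \<and> good I t"
  using eventually_happens[OF eventually_conj[OF eventually_gt_at_top[of s] eventually_good[of I]]] by auto

lemma stage_Suc: "stage (Suc I) = (LEAST t. stage I < t \<and> good (Suc I) t)"
  by (simp add: stage_def)

lemma stage_less: "stage I < stage (Suc I)"
  unfolding stage_Suc using LeastI_ex[OF ex_good[of "stage I" "Suc I"]] by simp

lemma good_stage: "good I (stage I)"
proof (cases I)
  case 0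
  then show ?thesis using LeastI_ex[OF ex_good[of 0 0]] by (simp add: stage_def)
next
  case (Suc J)
  then show ?thesis using LeastI_ex[OF ex_good[of "stage J" "Suc J"]] by (simp add: stage_Suc)
qed

lemma Suc_le_stage: "Suc I \<le> stage I"
proof (induction I)
  case 0
  then show ?case using LeastI_ex[OF ex_good[of 0 0]] by (simp add: stage_def)
next
  case (Suc I)
  then show ?case using stage_less[of I] by simp
qed

lemma stage_mono: "I \<le> I' \<Longrightarrow> stage I \<le> stage I'"
  by (rule lift_Suc_mono_le) (simp add: stage_less less_imp_le)

lemma approx_mono: "approx I \<subseteq> approx (Suc I)"
  unfolding approx_def using enumerated_mono stage_less less_imp_le by blast

lemma finite_approx: "finite (approx I)"
  by (rule finite_subset[of _ "{..<stage I}"]) (auto simp: approx_def dest: enumerated_bound)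

text \<open>\<open>M\<close> and \<open>final M\<close> are not found effectively, but they are
  fixed finite objects that the program may contain.\<close>

lemma cfun_stage: "cfun stage"
proof -
  have good: "cfun (\<lambda>z. good (f z) (g z))" if "cfun f" "cfun g" for f g :: "'a::enc \<Rightarrow> nat"
  proof -
    have "cfun (\<lambda>z. good (fst z) (snd z))"
      unfolding good_def horizon_def by (intro cfun_intros)
    from cfun_comp[OF this cfun_Pair[OF that]] show ?thesis by simp
  qed
  have "cfun (\<lambda>I. stage I)"
    unfolding stage_def by (intro cfun_intros good) (rule ex_good)
  then show ?thesis by simp
qed

lemma computable_approximation_approx: "computable_approximation approx A"
  unfolding computable_approximation_def
proof (intro conjI allI)
  have "cfun (\<lambda>I. foldl (\<lambda>s x. s + (if enumerated e (stage I) x then 2 ^ x else 0)) (0::nat) [0..<stage I])"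
    by (intro cfun_intros cfun_comp[OF cfun_stage])
  moreover have "foldl (\<lambda>s x. s + (if enumerated e (stage I) x then 2 ^ x else 0)) (0::nat) [0..<stage I] =
      set_encode (approx I)" for I
  proof -
    have "foldl (\<lambda>s x. s + (if P x then 2 ^ x else 0)) (0::nat) [0..<n] = (\<Sum>x\<in>{x. x < n \<and> P x}. 2 ^ x)"
      for P and n :: nat
    proof (induction n)
      case (Suc n)
      have "{x. x < Suc n \<and> P x} = (if P n then insert n {x. x < n \<and> P x} else {x. x < n \<and> P x})"
        by (auto simp: less_Suc_eq)
      with Suc show ?case by simp
    qed simp
    moreover have "approx I = {x. x < stage I \<and> enumerated e (stage I) x}"
      using enumerated_bound by (auto simp: approx_def)
    ultimately show ?thesis by (simp add: set_encode_def)
  qed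
  ultimately show "computable1 (\<lambda>I. set_encode (approx I))"
    by (simp add: cfun_nat_iff)
next
  fix x
  obtain s where s: "\<forall>t\<ge>s. enumerated e t x \<longleftrightarrow> x \<in> A"
    using eventually_enumerated_ce[of q "rcode p" x] unfolding e A eventually_sequentially by auto
  have "x \<in> approx I \<longleftrightarrow> x \<in> A" if "s \<le> I" for I
    using s that Suc_le_stage[of I] by (simp add: approx_def)
  then show "\<forall>\<^sub>F I in sequentially. x \<in> approx I \<longleftrightarrow> x \<in> A"
    unfolding eventually_sequentially by blast
qed (rule finite_approx)

subsection \<open>Summing the costs\<close>

lemma good_picture:
  assumes "good I t"
  shows "picture t M = final M" and "l \<le> e \<Longrightarrow> \<not> has_label (Suc l) (drop M (picture t (horizon I)))"
  using assms by (auto simp: good_def list_all_iff simp del: upt_Suc)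

lemma good_idle:
  assumes "good I t" "k \<le> horizon I"
  shows "\<not> has_label (Suc e) (picture t k)"
proof
  assume "has_label (Suc e) (picture t k)"
  then obtain co where co: "Some co \<in> set (picture t k)" "fst co = Suc e" unfolding has_label_iff by blast
  have "set (picture t k) \<subseteq> set (picture t (horizon I))"
    by (metis assms(2) set_take_subset take_picture)
  also have "picture t (horizon I) = final M @ drop M (picture t (horizon I))"
    by (metis append_take_drop_id M_le_horizon assms(1) good_picture(1) take_picture)
  finally have "Some co \<in> set (final M) \<or> Some co \<in> set (drop M (picture t (horizon I)))"
    using co(1) by auto
  then show False
    using no_label_final[OF e A red, of M] good_picture(2)[OF assms(1), of e] co(2)
    unfolding has_label_iff by blast
qed

text \<open>At good stages the outcomes before \<open>M\<close> agree, and from \<open>M\<close> on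
  the modules of requirements up to \<open>e\<close> are idle at both stages. What remains are
  requirements beyond \<open>e\<close> and bit modules; the first coordinate of the latter is their
  diagonal.\<close>

lemma first_change:
  assumes good: "good I t" "good I' t'" and k: "k < horizon I" "k < horizon I'"
    and ch: "picture t k = picture t' k" "picture t (Suc k) \<noteq> picture t' (Suc k)"
  shows "e < fst (prod_decode k)"
proof -
  have "M \<le> k"
  proof (rule ccontr)
    assume "\<not> M \<le> k"
    then have "Suc k \<le> M" by simp
    from take_picture[OF this, of t] take_picture[OF this, of t'] ch(2) good_picture(1)[OF good(1)]
      good_picture(1)[OF good(2)] show False by simp
  qed
  have none: "entry s k (picture s k) = None"
    if "fst (prod_decode k) \<le> e" "snd (prod_decode k) > 0" "good J s" "k < horizon J" for s J
  proof (cases "entry s k (picture s k)")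
    case (Some co)
    then have "fst co = Suc (fst (prod_decode k))"
      using entry_SomeD[OF Some] that(2) by (simp add: candidate_def Let_def)
    moreover have "Some co \<in> set (drop M (picture s (horizon J)))"
    proof -
      have "drop M (picture s (horizon J)) ! (k - M) = Some co"
        using \<open>M \<le> k\<close> that(4) Some by (simp add: nth_picture)
      moreover have "k - M < length (drop M (picture s (horizon J)))"
        using \<open>M \<le> k\<close> that(4) by simp
      ultimately show ?thesis by (metis nth_mem)
    qed
    ultimately have "has_label (Suc (fst (prod_decode k))) (drop M (picture s (horizon J)))"
      unfolding has_label_iff by blast
    with good_picture(2)[OF that(3) that(1)] show ?thesis by blast
  qed
  have "triangle (Suc e) \<le> k" using \<open>M \<le> k\<close> by (simp add: M_def)
  with diagonal_bounds(2)[of k] have "e < diagonal k"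
    by (meson leI le_less_trans less_le_trans linorder_not_le not_less_eq_eq triangle_mono)
  show ?thesis
  proof (cases "snd (prod_decode k) = 0")
    case True
    with \<open>e < diagonal k\<close> show ?thesis by (simp add: diagonal_def)
  next
    case False
    show ?thesis
    proof (rule ccontr)
      assume "\<not> e < fst (prod_decode k)"
      with False none good k have "entry t k (picture t k) = None" "entry t' k (picture t' k) = None"
        by auto
      with ch show False by (simp add: picture_Suc)
    qed
  qed
qed

section \<open>Cost of a single step\<close>

abbreviation step_cost :: "nat \<Rightarrow> real" where
  "step_cost I \<equiv> real_of_rat (stage_cost c approx (Suc I))"

lemma step_cost_cases:
  obtains "step_cost I = 0"
  | x where "x \<in> approx (Suc I)" "x \<notin> approx I" "step_cost I = cost x (Suc I)"
proof -
  define ch where "ch x \<longleftrightarrow> x < Suc I \<and> (x \<in> approx I) \<noteq> (x \<in> approx (Suc I))" for x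
  have sc: "stage_cost c approx (Suc I) = (if \<exists>x. ch x then c (LEAST x. ch x) (Suc I) else 0)"
    by (simp only: stage_cost_def Let_def ch_def diff_Suc_1)
  show thesis
  proof (cases "\<exists>x. ch x")
    case True
    then have "ch (LEAST x. ch x)" by (rule LeastI_ex)
    then have "(LEAST x. ch x) \<in> approx (Suc I)" "(LEAST x. ch x) \<notin> approx I"
      using approx_mono[of I] by (auto simp: ch_def[of "LEAST x. ch x"])
    with True that(2)[of "LEAST x. ch x"] show thesis by (simp add: sc cost_def)
  qed (simp add: sc that(1))
qed

lemma step_cost_nonneg: "0 \<le> step_cost I"
  by (rule step_cost_cases[of I]) (simp_all add: cost_nonneg)

lemma step_cost_le:
  assumes k: "k = prod_encode (e, i)" "i > 0" "k < horizon I"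
    and "picture (stage I) k = picture (stage (Suc I)) k"
  shows "step_cost I \<le> (1/2) ^ weight (len_index k) (len (len_index k) (stage I))"
proof (rule step_cost_cases[of I])
  fix x assume x: "x \<in> approx (Suc I)" "x \<notin> approx I" "step_cost I = cost x (Suc I)"
  have "len (Suc (len_index k)) (stage I) \<le> x"
  proof (rule agreement[OF k(1,2) _ assms(4)])
    show "\<not> has_label (Suc e) (picture (stage I) (Suc k))"
      using good_idle[OF good_stage] k(3) by simp
    show "\<not> has_label (Suc e) (picture (stage (Suc I)) (Suc k))"
      using good_idle[OF good_stage] k(3) horizon_mono[of I "Suc I"] by simp
  qed (use x stage_mono[of I "Suc I"] in \<open>auto simp: approx_def\<close>)
  then have "cost x (Suc I) \<le> cost (len (Suc (len_index k)) (stage I)) (stage I)"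
    using cost_antimono cost_mono[OF Suc_le_stage] by (meson order_trans)
  with cost_len x(3) show ?thesis by (metis order_trans)
qed simp

definition change :: "nat \<Rightarrow> bool" where
  "change I \<longleftrightarrow> picture (stage I) (horizon I) \<noteq> picture (stage (Suc I)) (horizon I)"

definition change_at :: "nat \<Rightarrow> nat" where
  "change_at I = (LEAST k. picture (stage I) (Suc k) \<noteq> picture (stage (Suc I)) (Suc k))"

lemma change_at:
  assumes "change I"
  shows "change_at I < horizon I"
    and "k \<le> change_at I \<Longrightarrow> picture (stage I) k = picture (stage (Suc I)) k"
    and "picture (stage I) (Suc (change_at I)) \<noteq> picture (stage (Suc I)) (Suc (change_at I))"
    and "e < fst (prod_decode (change_at I))"
proof -
  let ?P = "\<lambda>k. picture (stage I) (Suc k) \<noteq> picture (stage (Suc I)) (Suc k)"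
  obtain h where h: "horizon I = Suc h" by (simp add: horizon_def)
  with assms have "?P h" by (simp add: change_def)
  show less: "change_at I < horizon I"
    using Least_le[of ?P, OF \<open>?P h\<close>] h by (simp add: change_at_def)
  show P: "?P (change_at I)"
    unfolding change_at_def using \<open>?P h\<close> by (rule LeastI)
  show eq: "picture (stage I) k = picture (stage (Suc I)) k" if "k \<le> change_at I" for k
  proof (cases k)
    case (Suc m)
    with that not_less_Least[of m ?P] show ?thesis by (auto simp: change_at_def)
  qed simp
  show "e < fst (prod_decode (change_at I))"
    using first_change[OF good_stage good_stage less _ eq P] less horizon_mono[of I "Suc I"] by simp
qed

lemma step_cost_no_change:
  assumes "\<not> change I"
  shows "step_cost I \<le> (1/2) ^ I"
proof -
  let ?k = "prod_encode (e, M + Suc I)"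
  have eq: "picture (stage I) (horizon I) = picture (stage (Suc I)) (horizon I)"
    using assms by (simp add: change_def)
  have "picture (stage I) ?k = picture (stage (Suc I)) ?k"
    using take_picture[of ?k "horizon I"] eq by (metis horizon_def le_SucI le_refl)
  from step_cost_le[OF refl _ _ this] have "step_cost I \<le> (1/2) ^ weight (len_index ?k) (len (len_index ?k) (stage I))"
    by (simp add: horizon_def)
  also have "\<dots> \<le> (1/2) ^ I"
    using le_prod_encode_1[of "M + Suc I" e] by (intro power_decreasing) (auto simp: weight_def)
  finally show ?thesis .
qed

definition change_diagonal :: "nat \<Rightarrow> nat" where
  "change_diagonal I = diagonal (change_at I)"

text \<open>The length index of the module that requirement \<open>e\<close> has on diagonal
  \<open>b\<close>. Because of the swapped coordinates, the modules acting after it on this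
  diagonal, as well as all modules on smaller diagonals, have a smaller index.\<close>

definition rank :: "nat \<Rightarrow> nat" where
  "rank b = prod_encode (b - e, e)"

lemma change_diagonal_greater: "change I \<Longrightarrow> e < change_diagonal I"
  using change_at(4)[of I] by (simp add: change_diagonal_def diagonal_def)

text \<open>The changing module has first coordinate greater than \<open>e\<close>, so the module of
  requirement \<open>e\<close> on the same diagonal acts before it and sees an unchanged picture.
  Its agreement bounds the cost, and the two summands of \<open>weight\<close> yield the two
  factors.\<close>

lemma step_cost_change:
  assumes "change I"
  shows "step_cost I \<le> (1/2) ^ change_diagonal I *
    (\<Prod>m<rank (change_diagonal I). (1/2) ^ Suc (state (len_index m) (stage I)))"
proof -
  define b where "b = change_diagonal I"
  define n where "n = rank b"
  define l where "l = len n (stage I)"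
  have b: "e < b" using change_diagonal_greater[OF assms] by (simp add: b_def)
  let ?k = "prod_encode (e, b - e)"
  have "change_at I = prod_encode (fst (prod_decode (change_at I)), snd (prod_decode (change_at I)))"
    by simp
  also have "\<dots> = triangle b + fst (prod_decode (change_at I))"
    unfolding prod_encode_triangle by (simp add: b_def change_diagonal_def diagonal_def)
  finally have "?k < change_at I"
    using change_at(4)[OF assms] b by (simp add: prod_encode_triangle)
  then have "step_cost I \<le> (1/2) ^ weight n l"
    using step_cost_le[of ?k "b - e" I] change_at(1)[OF assms] change_at(2)[OF assms, of ?k] b
    by (simp add: n_def l_def rank_def)
  also have "\<dots> = (1/2) ^ n * (1/2) ^ (n * (4 * l + 2))"
    unfolding weight_def by (rule power_add)
  also have "\<dots> \<le> (1/2) ^ b * (\<Prod>m<n. (1/2) ^ Suc (state (len_index m) (stage I)))"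
  proof (rule mult_mono)
    have "b \<le> n" using b le_triangle[of b] by (simp add: n_def rank_def prod_encode_triangle)
    then show "(1/2 :: real) ^ n \<le> (1/2) ^ b" by (intro power_decreasing) auto
    have "Suc (state (len_index m) (stage I)) \<le> 4 * l + 2" if "m < n" for m
      using state_bound[of "len_index m" "stage I"] len_le[of "Suc m" n "stage I"] that by (simp add: l_def)
    then have "(\<Sum>m<n. Suc (state (len_index m) (stage I))) \<le> n * (4 * l + 2)"
      using sum_bounded_above[of "{..<n}" "\<lambda>m. Suc (state (len_index m) (stage I))" "4 * l + 2"] by simp
    then show "(1/2 :: real) ^ (n * (4 * l + 2)) \<le> (\<Prod>m<n. (1/2) ^ Suc (state (len_index m) (stage I)))"
      unfolding power_sum[symmetric] by (intro power_decreasing) auto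
  qed auto
  finally show ?thesis by (simp add: n_def b_def)
qed

text \<open>Take the first module \<open>m\<close> that changes at any step between the two samples.
  The modules before it stand still throughout, so its state never decreases and grows at its
  change. As \<open>m\<close> is at most \<open>change_at I\<close> and has first coordinate greater
  than \<open>e\<close>, its length index is below \<open>rank b\<close>.\<close>

lemma states_distinct:
  assumes ch: "change I" and less: "I < I'" and b: "change_diagonal I = b"
  shows "\<exists>m<rank b. state (len_index m) (stage I) \<noteq> state (len_index m) (stage I')"
proof -
  define P where "P m \<longleftrightarrow> (\<exists>J. I \<le> J \<and> J < I' \<and> picture (stage J) (Suc m) \<noteq> picture (stage (Suc J)) (Suc m))" for m
  define m where "m = (LEAST m. P m)"
  have P: "P (change_at I)" using change_at(3)[OF ch] less unfolding P_def by blast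
  then have "P m" "m \<le> change_at I" unfolding m_def by (auto intro: LeastI Least_le)
  have step: "picture (stage J) m = picture (stage (Suc J)) m" if "I \<le> J" "J < I'" for J
  proof (cases m)
    case (Suc m')
    then have "\<not> P m'" using not_less_Least[of m' P] by (simp add: m_def)
    with that Suc show ?thesis by (auto simp: P_def)
  qed simp
  have same: "picture (stage J) m = picture (stage I) m" if "I \<le> J" "J \<le> I'" for J
    using that by (induction J rule: dec_induct) (auto simp: step)
  obtain J where J: "I \<le> J" "J < I'" "picture (stage J) (Suc m) \<noteq> picture (stage (Suc J)) (Suc m)"
    using \<open>P m\<close> unfolding P_def by blast
  have "state m (stage I) \<le> state m (stage J)"
    using J by (intro state_mono(1) stage_mono) (auto simp: same[of J])
  also have "\<dots> < state m (stage (Suc J))"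
    using J by (intro state_mono(2) stage_mono step) auto
  also have "\<dots> \<le> state m (stage I')"
    using J by (intro state_mono(1) stage_mono) (auto simp: same[of "Suc J"] same[of I'])
  finally have "state m (stage I) \<noteq> state m (stage I')" by simp
  moreover have "len_index m < rank b"
  proof -
    have "m < horizon J"
      using \<open>m \<le> change_at I\<close> change_at(1)[OF ch] horizon_mono[OF J(1)] by simp
    then have e_less: "e < fst (prod_decode m)"
      using first_change[OF good_stage good_stage _ _ step J(3)] J horizon_mono[of J "Suc J"] by simp
    have "diagonal m \<le> b"
      using diagonal_mono[OF \<open>m \<le> change_at I\<close>] b by (simp add: change_diagonal_def)
    have idx: "len_index m = triangle (diagonal m) + snd (prod_decode m)"
      unfolding len_index_def prod_encode_triangle by (simp add: diagonal_def add.commute)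
    have rank: "rank b = triangle b + (b - e)"
      using change_diagonal_greater[OF ch] b by (simp add: rank_def prod_encode_triangle)
    show ?thesis
    proof (cases "diagonal m = b")
      case True
      with e_less show ?thesis unfolding idx rank by (auto simp: diagonal_def)
    next
      case False
      with \<open>diagonal m \<le> b\<close> have "Suc (diagonal m) \<le> b" by simp
      from triangle_mono[OF this] have "triangle (diagonal m) + Suc (diagonal m) \<le> triangle b" by simp
      moreover have "snd (prod_decode m) \<le> diagonal m" by (simp add: diagonal_def)
      ultimately show ?thesis unfolding idx rank by simp
    qed
  qed
  ultimately show ?thesis by (intro exI[of _ "len_index m"]) simp
qed

text \<open>The total is at most 4: the steps without change form part of a geometric series, and by
  the Kraft-type inequality all changes on diagonal \<open>b\<close> together cost at most
  \<open>(1/2) ^ b\<close>.\<close>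

lemma obeys_A: "obeys A c"
  unfolding obeys_def
proof (intro exI conjI)
  show "computable_approximation approx A" by (rule computable_approximation_approx)
  show "summable step_cost"
  proof (rule summableI_nonneg_bounded)
    fix N
    define J where "J = {I. I < N \<and> change I}"
    have fin: "finite J" by (simp add: J_def)
    have "sum step_cost {..<N} = sum step_cost ({..<N} - J) + sum step_cost J"
      by (rule sum.subset_diff) (auto simp: J_def)
    also have "sum step_cost ({..<N} - J) \<le> (\<Sum>I\<in>{..<N} - J. (1/2) ^ I)"
      by (intro sum_mono step_cost_no_change) (auto simp: J_def)
    also have "\<dots> \<le> 2" by (intro sum_half_powers_le) simp
    also have "sum step_cost J = (\<Sum>b\<in>change_diagonal ` J. sum step_cost {I\<in>J. change_diagonal I = b})"
      by (rule sum.image_gen[OF fin])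
    also have "\<dots> \<le> (\<Sum>b\<in>change_diagonal ` J. (1/2) ^ b)"
    proof (rule sum_mono)
      fix b
      let ?J = "{I\<in>J. change_diagonal I = b}"
      have "sum step_cost ?J \<le>
          (\<Sum>I\<in>?J. (1/2) ^ b * (\<Prod>m<rank b. (1/2) ^ Suc (state (len_index m) (stage I))))"
      proof (rule sum_mono)
        fix I assume "I \<in> ?J"
        then show "step_cost I \<le> (1/2) ^ b * (\<Prod>m<rank b. (1/2) ^ Suc (state (len_index m) (stage I)))"
          using step_cost_change[of I] by (simp add: J_def)
      qed
      also have "\<dots> = (1/2) ^ b * (\<Sum>I\<in>?J. \<Prod>m<rank b. (1/2) ^ Suc (state (len_index m) (stage I)))"
        by (simp only: sum_distrib_left)
      also have "\<dots> \<le> (1/2) ^ b * 1"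
      proof (intro mult_left_mono sum_distinct_vectors_le)
        fix I I' assume "I \<in> ?J" "I' \<in> ?J" "I \<noteq> I'"
        then show "\<exists>m<rank b. state (len_index m) (stage I) \<noteq> state (len_index m) (stage I')"
          using states_distinct[of I I' b] states_distinct[of I' I b] unfolding J_def
          by (metis (mono_tags, lifting) mem_Collect_eq linorder_neqE_nat)
      qed (use fin in auto)
      finally show "sum step_cost ?J \<le> (1/2) ^ b" by simp
    qed
    also have "\<dots> \<le> 2" by (intro sum_half_powers_le) (simp add: fin)
    finally show "sum step_cost {..<N} \<le> 2 + 2" by simp
  qed (rule step_cost_nonneg)
qed

end

theorem theorem6p1:
  fixes P :: "nat set set" and c :: "nat \<Rightarrow> nat \<Rightarrow> rat"
  assumes "pi01_class P" and "P \<noteq> {}"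
    and "cost_function c" and "monotonic_cost c" and "limit_condition c"
  shows "\<exists>Y\<in>P. delta02 Y \<and> (\<forall>A. ce_set A \<and> A \<le>\<^sub>T Y \<longrightarrow> obeys A c)"
proof -
  obtain T where T: "computable_tree T" "P = paths T"
    using assms(1) unfolding pi01_class_def by blast
  obtain num den where "computable2 num" "computable2 den" "\<And>x s. den x s > 0"
    "\<And>x s. c x s = of_nat (num x s) / of_nat (den x s)"
    using assms(3) unfolding cost_function_def by blast
  then interpret cost_construction T c num den
    using T assms by unfold_locales auto
  show ?thesis
  proof (intro bexI conjI allI impI)
    show "delta02 limit_path" by (rule delta02_limit_path)
    show "limit_path \<in> P" using limit_path_in_paths T(2) by simp
    fix A assume A: "ce_set A \<and> A \<le>\<^sub>T limit_path"
    then obtain q where "A = {x. \<exists>y. reval {} q [x] y}" unfolding ce_set_def by blast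
    moreover obtain p where "\<And>xs. length xs = 1 \<Longrightarrow> reval limit_path p xs (of_bool (xs ! 0 \<in> A))"
      using A unfolding turing_reducible_def computable_in_def by blast
    from this[of "[_]"] have "\<And>x. reval limit_path p [x] (of_bool (x \<in> A))" by simp
    ultimately interpret requirement T c num den "prod_encode (rcode q, rcode p)" q p A
      by unfold_locales auto
    show "obeys A c" by (rule obeys_A)
  qed
qed

end
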